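(* Let $q=q(z,t)$, $b=b(z,t)$ and $Q=Q(t,u_4)$ be arbitrary functions. Each of the following four equations for $u=u(x^1,x^2,x^3,x^4)$ possesses a recursion operator for symmetries, defined by the indicated system relating $\varphi$ and $\psi$ (where the denominators do not vanish): (D) $u_{14}u_{23}-u_{13}u_{24}=\mathcal Q$, where $\mathcal Q=q_z u_4-q_t u_3+b$, with $$\psi_1=\tfrac1{\mathcal Q}\bigl(u_{13}(q\psi_4+\varphi_4)-u_{14}(q\psi_3+\varphi_3)\bigr),\quad \psi_2=\tfrac1{\mathcal Q}\bigl(u_{23}(q\psi_4+\varphi_4)-u_{24}(q\psi_3+\varphi_3)\bigr);$$ (III) $u_{24}-u_{14}u_{33}+u_{13}u_{34}=Q\,u_{34}$, with $$\psi_3=u_{33}\varphi_1-\varphi_2-u_{13}\varphi_3,\quad \psi_4=u_{34}\varphi_1-u_{14}\varphi_3-Q\varphi_4;$$ (II) $u_{12}u_{34}-u_{13}u_{24}=Q\,u_{14}$, with $$\psi_2=\tfrac1{Q u_{14}}\bigl(Q u_{12}\psi_4+u_{24}\varphi_1-u_{12}\varphi_4\bigr),\quad \psi_3=\tfrac1{Q u_{14}}\bigl(Q u_{13}\psi_4+u_{34}\varphi_1-u_{13}\varphi_4\bigr);$$ (I) $u_{12}u_{34}-u_{13}u_{24}=Q\,(u_{12}u_{34}-u_{14}u_{23})$, with $$\psi_1=Q\tfrac{u_{14}}{u_{24}}\varphi_2-\varphi_1-(Q-1)\tfrac{u_{12}}{u_{24}}\varphi_4+\tfrac{u_{12}}{u_{24}}\psi_4,\quad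 \psi_3=(Q-1)\tfrac{u_{34}}{u_{24}}\varphi_2-(Q-1)\tfrac{u_{23}}{u_{24}}\varphi_4+\tfrac{u_{23}}{u_{24}}\psi_4.$$
   Context: Coordinates: $(x,y,z,t)=(x^1,x^2,x^3,x^4)$; $u_i,u_{ij}$ are partial derivatives of $u$, and $\varphi_i,\psi_i$ denote (total) derivatives of $\varphi,\psi$ with respect to $x^i$. For an equation $\mathcal E:\ F=0$ the linearization is $\ell_F(\varphi)=\sum_\sigma\frac{\partial F}{\partial u_\sigma}D_\sigma\varphi$; solutions $\varphi$ of $\ell_F(\varphi)=0$ on $\mathcal E$ are the (possibly nonlocal) symmetries, and the tangent covering of $\mathcal E$ is the system $F=0$, $\ell_F(\varphi)=0$. A recursion operator is a Bäcklund auto-transformation of the tangent covering: a system of differential relations between $\varphi$ and $\psi$ over a solution $u$ of $\mathcal E$ such that, if $\varphi$ satisfies the linearized equation $\ell_F(\varphi)=0$, the system is compatible as an overdetermined system for $\psi$, and every solution $\psi$ again satisfies the linearized equation $\ell_F(\psi)=0$. *)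

theory Defs
  imports "HOL-Analysis.Analysis" "HOL-Library.Multiset"
begin

section \<open>Partial derivatives and smooth functions\<close>

definition dir_deriv :: "'a::euclidean_space \<Rightarrow> ('a \<Rightarrow> real) \<Rightarrow> 'a \<Rightarrow> real" where
  "dir_deriv v f x = frechet_derivative f (at x) v"

primrec Ck_on :: "nat \<Rightarrow> 'a::euclidean_space set \<Rightarrow> ('a \<Rightarrow> real) \<Rightarrow> bool" where
  "Ck_on 0 U f \<longleftrightarrow> continuous_on U f"
| "Ck_on (Suc n) U f \<longleftrightarrow>
     (\<forall>x\<in>U. f differentiable (at x)) \<and> (\<forall>e\<in>Basis. Ck_on n U (dir_deriv e f))"

definition smooth_on :: "'a::euclidean_space set \<Rightarrow> ('a \<Rightarrow> real) \<Rightarrow> bool" where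
  "smooth_on U f \<longleftrightarrow> (\<forall>n. Ck_on n U f)"

text \<open>
  The independent variables are \<open>(x, y, z, t) = (x $ 1, x $ 2, x $ 3, x $ 4)\<close>. The index type
  \<open>4\<close> is the type with exactly the four elements 1, 2, 3, 4 (where \<open>4 = 0\<close>).
\<close>

abbreviation pd :: "4 \<Rightarrow> (real^4 \<Rightarrow> real) \<Rightarrow> real^4 \<Rightarrow> real" where
  "pd i \<equiv> dir_deriv (axis i 1)"


section \<open>Jets\<close>

text \<open>
  A multi-index \<open>\<sigma>\<close> is a multiset of indices, so that \<open>{#1, 4#} = {#4, 1#}\<close> indexes the single
  jet coordinate \<open>u\<^sub>1\<^sub>4\<close>, and \<open>{#}\<close> indexes \<open>u\<close> itself.
\<close>

type_synonym jet = "4 multiset \<Rightarrow> real"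

definition multi_deriv :: "4 multiset \<Rightarrow> (real^4 \<Rightarrow> real) \<Rightarrow> real^4 \<Rightarrow> real" where
  "multi_deriv \<sigma> =
     (pd 1 ^^ count \<sigma> 1) \<circ> (pd 2 ^^ count \<sigma> 2) \<circ> (pd 3 ^^ count \<sigma> 3) \<circ> (pd 4 ^^ count \<sigma> 4)"

definition jet_of :: "(real^4 \<Rightarrow> real) \<Rightarrow> real^4 \<Rightarrow> jet" where
  "jet_of f x = (\<lambda>\<sigma>. multi_deriv \<sigma> f x)"

definition jet_partial :: "4 multiset \<Rightarrow> (jet \<Rightarrow> real) \<Rightarrow> jet \<Rightarrow> real" where
  "jet_partial \<sigma> G p = deriv (\<lambda>a. G (p(\<sigma> := a))) (p \<sigma>)"

lemma finite_multi_indices: "finite {\<sigma> :: 4 multiset. size \<sigma> \<le> n}"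
proof (rule finite_subset)
  show "{\<sigma> :: 4 multiset. size \<sigma> \<le> n} \<subseteq> mset ` {xs. set xs \<subseteq> UNIV \<and> length xs \<le> n}"
  proof
    fix \<sigma> :: "4 multiset"
    assume "\<sigma> \<in> {\<sigma>. size \<sigma> \<le> n}"
    moreover obtain xs where "mset xs = \<sigma>" using ex_mset by blast
    ultimately show "\<sigma> \<in> mset ` {xs. set xs \<subseteq> UNIV \<and> length xs \<le> n}" by auto
  qed
  show "finite (mset ` {xs :: 4 list. set xs \<subseteq> UNIV \<and> length xs \<le> n})"
    by (intro finite_imageI finite_lists_length_le) simp
qed


section \<open>Second-order equations and their linearization\<close>

text \<open>A second-order equation \<open>F(x, u, u\<^sub>i, u\<^sub>i\<^sub>j) = 0\<close> is given by its left-hand side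
  \<open>F x p\<close> as a function of the point \<open>x\<close> and the jet \<open>p\<close> of \<open>u\<close>.\<close>

type_synonym pde = "real^4 \<Rightarrow> jet \<Rightarrow> real"

definition solves :: "(real^4) set \<Rightarrow> pde \<Rightarrow> (real^4 \<Rightarrow> real) \<Rightarrow> bool" where
  "solves U F u \<longleftrightarrow> smooth_on U u \<and> (\<forall>x\<in>U. F x (jet_of u x) = 0)"

definition linearization :: "pde \<Rightarrow> (real^4 \<Rightarrow> real) \<Rightarrow> (real^4 \<Rightarrow> real) \<Rightarrow> real^4 \<Rightarrow> real" where
  "linearization F u \<phi> x =
     (\<Sum>\<sigma> | size \<sigma> \<le> 2. jet_partial \<sigma> (F x) (jet_of u x) * multi_deriv \<sigma> \<phi> x)"

definition solves_linearized ::
    "(real^4) set \<Rightarrow> pde \<Rightarrow> (real^4 \<Rightarrow> real) \<Rightarrow> (real^4 \<Rightarrow> real) \<Rightarrow> bool" where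
  "solves_linearized U F u \<phi> \<longleftrightarrow> smooth_on U \<phi> \<and> (\<forall>x\<in>U. linearization F u \<phi> x = 0)"


section \<open>Recursion operators\<close>

text \<open>
  A pair \<open>(i, A)\<close> stands for the relation \<open>\<psi>\<^sub>i = A x p r s\<close>, where \<open>p\<close>, \<open>r\<close>, \<open>s\<close> are the jets at
  \<open>x\<close> of \<open>u\<close>, \<open>\<phi>\<close>, \<open>\<psi>\<close>, and \<open>A\<close> involves at most first-order derivatives of \<open>\<psi>\<close>. Over fixed \<open>u\<close>
  and \<open>\<phi>\<close> such relations form a first-order system for \<open>\<psi>\<close>, with right-hand sides
  depending on \<open>x\<close> and on the jet of \<open>\<psi>\<close> only.
\<close>

type_synonym psi_system = "(4 \<times> (real^4 \<Rightarrow> jet \<Rightarrow> real)) set"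
type_synonym relations = "(4 \<times> (real^4 \<Rightarrow> jet \<Rightarrow> jet \<Rightarrow> jet \<Rightarrow> real)) set"

definition system_over :: "relations \<Rightarrow> (real^4 \<Rightarrow> real) \<Rightarrow> (real^4 \<Rightarrow> real) \<Rightarrow> psi_system" where
  "system_over R u \<phi> = (\<lambda>(i, A). (i, \<lambda>x s. A x (jet_of u x) (jet_of \<phi> x) s)) ` R"

definition solves_system :: "(real^4) set \<Rightarrow> psi_system \<Rightarrow> (real^4 \<Rightarrow> real) \<Rightarrow> bool" where
  "solves_system U S \<psi> \<longleftrightarrow>
     smooth_on U \<psi> \<and> (\<forall>(i, A)\<in>S. \<forall>x\<in>U. pd i \<psi> x = A x (jet_of \<psi> x))"

text \<open>The total derivative \<open>D\<^sub>k A\<close> of a function on the space of first-order jets of \<open>\<psi>\<close>.\<close>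

definition total_deriv :: "4 \<Rightarrow> (real^4 \<Rightarrow> jet \<Rightarrow> real) \<Rightarrow> real^4 \<Rightarrow> jet \<Rightarrow> real" where
  "total_deriv k A x s =
     pd k (\<lambda>y. A y s) x + (\<Sum>\<sigma> | size \<sigma> \<le> 1. jet_partial \<sigma> (A x) s * s (add_mset k \<sigma>))"

text \<open>
  Compatibility of the overdetermined system \<open>\<psi>\<^sub>i = A\<^sub>i\<close>: the cross-derivatives of \<open>\<psi>\<close>
  computed from any two relations agree, \<open>D\<^sub>j A\<^sub>i = D\<^sub>i A\<^sub>j\<close>, by virtue of the system. The jet \<open>s\<close> of
  \<open>\<psi>\<close> ranges over all jets constrained only by the relations and by their derivatives in the
  directions \<open>k\<close> for which \<open>\<psi>\<^sub>k\<close> is not itself given by the system; these constraints express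
  \<open>\<psi>\<^sub>i\<close> and \<open>\<psi>\<^sub>i\<^sub>k\<close> through the remaining derivatives, which stay arbitrary.
\<close>

definition compatible :: "(real^4) set \<Rightarrow> psi_system \<Rightarrow> bool" where
  "compatible U S \<longleftrightarrow>
     (\<forall>x\<in>U. \<forall>s.
        (\<forall>(i, A)\<in>S. s {#i#} = A x s) \<and>
        (\<forall>(i, A)\<in>S. \<forall>k. k \<notin> fst ` S \<longrightarrow> s {#i, k#} = total_deriv k A x s) \<longrightarrow>
        (\<forall>(i, A)\<in>S. \<forall>(j, B)\<in>S. total_deriv j A x s = total_deriv i B x s))"

text \<open>
  \<open>\<Omega>\<close> is the set of those points and jets of \<open>u\<close> at which the equation and the relations are
  defined (in particular, at which the denominators do not vanish). The open set \<open>U\<close> is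
  arbitrary, so that all local solutions are covered.
\<close>

definition recursion_operator :: "((real^4) \<times> jet) set \<Rightarrow> pde \<Rightarrow> relations \<Rightarrow> bool" where
  "recursion_operator \<Omega> F R \<longleftrightarrow>
     (\<forall>U u \<phi>. open U \<longrightarrow> solves U F u \<longrightarrow> (\<forall>x\<in>U. (x, jet_of u x) \<in> \<Omega>) \<longrightarrow>
        solves_linearized U F u \<phi> \<longrightarrow>
          compatible U (system_over R u \<phi>) \<and>
          (\<forall>\<psi>. solves_system U (system_over R u \<phi>) \<psi> \<longrightarrow> solves_linearized U F u \<psi>))"


section \<open>The four equations\<close>

text \<open>The functions \<open>q\<close>, \<open>b\<close> take the argument \<open>(z, t)\<close>, the function \<open>Q\<close> takes \<open>(t, u\<^sub>4)\<close>;
  they need only be defined on open sets \<open>V\<close>, \<open>W\<close>.\<close>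

type_synonym fun2 = "real \<times> real \<Rightarrow> real"

definition cal_Q :: "fun2 \<Rightarrow> fun2 \<Rightarrow> pde" where
  "cal_Q q b x p =
     dir_deriv (1, 0) q (x$3, x$4) * p {#4#} - dir_deriv (0, 1) q (x$3, x$4) * p {#3#}
       + b (x$3, x$4)"

definition dom_D :: "(real \<times> real) set \<Rightarrow> fun2 \<Rightarrow> fun2 \<Rightarrow> ((real^4) \<times> jet) set" where
  "dom_D V q b = {(x, p). (x$3, x$4) \<in> V \<and> cal_Q q b x p \<noteq> 0}"

definition eq_D :: "fun2 \<Rightarrow> fun2 \<Rightarrow> pde" where
  "eq_D q b x p = p {#1,4#} * p {#2,3#} - p {#1,3#} * p {#2,4#} - cal_Q q b x p"

definition rel_D :: "fun2 \<Rightarrow> fun2 \<Rightarrow> relations" where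
  "rel_D q b =
    {(1, \<lambda>x p r s. 1 / cal_Q q b x p *
           (p {#1,3#} * (q (x$3, x$4) * s {#4#} + r {#4#})
             - p {#1,4#} * (q (x$3, x$4) * s {#3#} + r {#3#}))),
     (2, \<lambda>x p r s. 1 / cal_Q q b x p *
           (p {#2,3#} * (q (x$3, x$4) * s {#4#} + r {#4#})
             - p {#2,4#} * (q (x$3, x$4) * s {#3#} + r {#3#})))}"

definition dom_III :: "(real \<times> real) set \<Rightarrow> ((real^4) \<times> jet) set" where
  "dom_III W = {(x, p). (x$4, p {#4#}) \<in> W}"

definition eq_III :: "fun2 \<Rightarrow> pde" where
  "eq_III Q x p =
     p {#2,4#} - p {#1,4#} * p {#3,3#} + p {#1,3#} * p {#3,4#} - Q (x$4, p {#4#}) * p {#3,4#}"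

definition rel_III :: "fun2 \<Rightarrow> relations" where
  "rel_III Q =
    {(3, \<lambda>x p r s. p {#3,3#} * r {#1#} - r {#2#} - p {#1,3#} * r {#3#}),
     (4, \<lambda>x p r s. p {#3,4#} * r {#1#} - p {#1,4#} * r {#3#} - Q (x$4, p {#4#}) * r {#4#})}"

definition dom_II :: "(real \<times> real) set \<Rightarrow> fun2 \<Rightarrow> ((real^4) \<times> jet) set" where
  "dom_II W Q = {(x, p). (x$4, p {#4#}) \<in> W \<and> Q (x$4, p {#4#}) * p {#1,4#} \<noteq> 0}"

definition eq_II :: "fun2 \<Rightarrow> pde" where
  "eq_II Q x p =
     p {#1,2#} * p {#3,4#} - p {#1,3#} * p {#2,4#} - Q (x$4, p {#4#}) * p {#1,4#}"

definition rel_II :: "fun2 \<Rightarrow> relations" where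
  "rel_II Q =
    {(2, \<lambda>x p r s. 1 / (Q (x$4, p {#4#}) * p {#1,4#}) *
           (Q (x$4, p {#4#}) * p {#1,2#} * s {#4#} + p {#2,4#} * r {#1#} - p {#1,2#} * r {#4#})),
     (3, \<lambda>x p r s. 1 / (Q (x$4, p {#4#}) * p {#1,4#}) *
           (Q (x$4, p {#4#}) * p {#1,3#} * s {#4#} + p {#3,4#} * r {#1#} - p {#1,3#} * r {#4#}))}"

definition dom_I :: "(real \<times> real) set \<Rightarrow> ((real^4) \<times> jet) set" where
  "dom_I W = {(x, p). (x$4, p {#4#}) \<in> W \<and> p {#2,4#} \<noteq> 0}"

definition eq_I :: "fun2 \<Rightarrow> pde" where
  "eq_I Q x p =
     p {#1,2#} * p {#3,4#} - p {#1,3#} * p {#2,4#}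
       - Q (x$4, p {#4#}) * (p {#1,2#} * p {#3,4#} - p {#1,4#} * p {#2,3#})"

definition rel_I :: "fun2 \<Rightarrow> relations" where
  "rel_I Q =
    {(1, \<lambda>x p r s. Q (x$4, p {#4#}) * (p {#1,4#} / p {#2,4#}) * r {#2#} - r {#1#}
           - (Q (x$4, p {#4#}) - 1) * (p {#1,2#} / p {#2,4#}) * r {#4#}
           + p {#1,2#} / p {#2,4#} * s {#4#}),
     (3, \<lambda>x p r s. (Q (x$4, p {#4#}) - 1) * (p {#3,4#} / p {#2,4#}) * r {#2#}
           - (Q (x$4, p {#4#}) - 1) * (p {#2,3#} / p {#2,4#}) * r {#4#}
           + p {#2,3#} / p {#2,4#} * s {#4#})}"

end

theory Submission
  imports Defs
begin

text \<open>
  By virtue of the equation for \<open>u\<close>, the relations between \<open>\<phi>\<close> and \<open>\<psi>\<close> imply relations without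
  denominators; e.g. for (D) these are
  \<open>q \<psi>\<^sub>3 + \<phi>\<^sub>3 = u\<^sub>1\<^sub>3 \<psi>\<^sub>2 - u\<^sub>2\<^sub>3 \<psi>\<^sub>1\<close> and \<open>q \<psi>\<^sub>4 + \<phi>\<^sub>4 = u\<^sub>1\<^sub>4 \<psi>\<^sub>2 - u\<^sub>2\<^sub>4 \<psi>\<^sub>1\<close>. A combination of their
  total derivatives in which the second derivatives of \<open>\<phi>\<close> form \<open>\<ell>\<^sub>F(\<phi>)\<close> leaves the compatibility
  condition multiplied by a nonvanishing denominator; another combination, in which the second
  derivatives of \<open>\<psi>\<close> form \<open>\<ell>\<^sub>F(\<psi>)\<close>, gives the linearized equation for \<open>\<psi>\<close>. If \<open>\<psi>\<^sub>i\<close> is read as the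
  right-hand side of its relation, the polynomial relations hold for arbitrary jets of \<open>\<psi>\<close> over the
  open set \<open>U\<close>, so they can be differentiated totally.
\<close>

section \<open>Directional derivatives and mixed partials\<close>

lemma dir_deriv_eq: "(f has_derivative f') (at x) \<Longrightarrow> dir_deriv v f x = f' v"
  unfolding dir_deriv_def by (metis frechet_derivative_at)

lemma has_derivative_dir_deriv:
  "f differentiable (at x) \<Longrightarrow> (f has_derivative (\<lambda>v. dir_deriv v f x)) (at x)"
  unfolding dir_deriv_def using frechet_derivative_works by blast

text \<open>Differentiability is not assumed: both functions have the same set of derivatives at
  \<open>x\<close>, so the choice operator behind \<open>frechet_derivative\<close> returns the same
  value for both.\<close>

lemma dir_deriv_cong:
  assumes "open U" "x \<in> U" "\<And>y. y \<in> U \<Longrightarrow> f y = g y"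
  shows "dir_deriv v f x = dir_deriv v g x"
proof -
  have "(f has_derivative f') (at x) \<longleftrightarrow> (g has_derivative f') (at x)" for f'
    using has_derivative_transform_within_open[OF _ assms(1,2), of f f' UNIV g]
      has_derivative_transform_within_open[OF _ assms(1,2), of g f' UNIV f] assms(3) by auto
  then show ?thesis by (simp add: dir_deriv_def frechet_derivative_def)
qed

lemma smooth_on_dir_deriv: "smooth_on U f \<Longrightarrow> e \<in> Basis \<Longrightarrow> smooth_on U (dir_deriv e f)"
  unfolding smooth_on_def by (meson Ck_on.simps(2))

lemma smooth_on_differentiable: "smooth_on U f \<Longrightarrow> x \<in> U \<Longrightarrow> f differentiable (at x)"
  unfolding smooth_on_def by (meson Ck_on.simps(2))

lemma smooth_on_continuous: "smooth_on U f \<Longrightarrow> continuous_on U f"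
  unfolding smooth_on_def by (meson Ck_on.simps(1))

section \<open>Symmetry of second derivatives\<close>

lemma DERIV_along_line:
  assumes "f differentiable (at (a + t *\<^sub>R v))"
  shows "((\<lambda>t. f (a + t *\<^sub>R v)) has_real_derivative dir_deriv v f (a + t *\<^sub>R v)) (at t)"
proof -
  have "((\<lambda>t. f (a + t *\<^sub>R v)) has_derivative (\<lambda>h. dir_deriv (h *\<^sub>R v) f (a + t *\<^sub>R v))) (at t)"
    by (rule has_derivative_compose[where g = f and f = "\<lambda>t. a + t *\<^sub>R v" and f' = "\<lambda>h. h *\<^sub>R v"])
       (auto intro!: derivative_eq_intros has_derivative_dir_deriv assms)
  moreover have "dir_deriv (h *\<^sub>R v) f (a + t *\<^sub>R v) = dir_deriv v f (a + t *\<^sub>R v) * h" for h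
    using linear_cmul[OF has_derivative_linear[OF has_derivative_dir_deriv[OF assms]]] by simp
  ultimately show ?thesis
    by (simp add: has_field_derivative_def)
qed

text \<open>The mean value theorem is applied twice: in direction \<open>v\<close> to the increment
  of \<open>f\<close> along \<open>h *\<^sub>R w\<close>, then in direction \<open>w\<close> to the
  derivative so obtained.\<close>

lemma second_difference_mean_value:
  fixes f :: "'a::euclidean_space \<Rightarrow> real"
  assumes "0 < h"
    and d1: "\<And>s t. 0 \<le> s \<Longrightarrow> s \<le> h \<Longrightarrow> 0 \<le> t \<Longrightarrow> t \<le> h \<Longrightarrow>
      f differentiable (at (x + s *\<^sub>R v + t *\<^sub>R w))"
    and d2: "\<And>s t. 0 \<le> s \<Longrightarrow> s \<le> h \<Longrightarrow> 0 \<le> t \<Longrightarrow> t \<le> h \<Longrightarrow>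
      dir_deriv v f differentiable (at (x + s *\<^sub>R v + t *\<^sub>R w))"
  shows "\<exists>s t. 0 < s \<and> s < h \<and> 0 < t \<and> t < h \<and>
    f (x + h *\<^sub>R v + h *\<^sub>R w) - f (x + h *\<^sub>R v) - f (x + h *\<^sub>R w) + f x
      = h * h * dir_deriv w (dir_deriv v f) (x + s *\<^sub>R v + t *\<^sub>R w)"
proof -
  define g where "g s = f ((x + h *\<^sub>R w) + s *\<^sub>R v) - f (x + s *\<^sub>R v)" for s
  have "(g has_real_derivative
      dir_deriv v f ((x + h *\<^sub>R w) + s *\<^sub>R v) - dir_deriv v f (x + s *\<^sub>R v)) (at s)"
    if "0 \<le> s" "s \<le> h" for s
    unfolding g_def using that d1[of s h] d1[of s 0] \<open>0 < h\<close>
    by (intro DERIV_diff DERIV_along_line) (auto simp: algebra_simps)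
  from MVT2[OF \<open>0 < h\<close> this] obtain s where s: "0 < s" "s < h"
    "g h - g 0 = h * (dir_deriv v f ((x + h *\<^sub>R w) + s *\<^sub>R v) - dir_deriv v f (x + s *\<^sub>R v))"
    by auto
  have "((\<lambda>t. dir_deriv v f ((x + s *\<^sub>R v) + t *\<^sub>R w)) has_real_derivative
      dir_deriv w (dir_deriv v f) ((x + s *\<^sub>R v) + t *\<^sub>R w)) (at t)"
    if "0 \<le> t" "t \<le> h" for t
    using that d2[of s t] s by (intro DERIV_along_line) auto
  from MVT2[OF \<open>0 < h\<close> this] obtain t where t: "0 < t" "t < h"
    "dir_deriv v f ((x + s *\<^sub>R v) + h *\<^sub>R w) - dir_deriv v f (x + s *\<^sub>R v)
      = h * dir_deriv w (dir_deriv v f) ((x + s *\<^sub>R v) + t *\<^sub>R w)"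
    by auto
  have "f (x + h *\<^sub>R v + h *\<^sub>R w) - f (x + h *\<^sub>R v) - f (x + h *\<^sub>R w) + f x = g h - g 0"
    by (simp add: g_def algebra_simps)
  also have "\<dots> = h * h * dir_deriv w (dir_deriv v f) (x + s *\<^sub>R v + t *\<^sub>R w)"
    using s(3) t(3) by (simp add: algebra_simps)
  finally show ?thesis using s t by blast
qed

text \<open>The second difference is symmetric in \<open>v\<close> and \<open>w\<close>, so both
  mixed derivatives take a common value at points arbitrarily close to \<open>x\<close>; continuity
  then forces equality at \<open>x\<close>.\<close>

lemma dir_deriv_commute:
  fixes f :: "'a::euclidean_space \<Rightarrow> real"
  assumes "open U" "x \<in> U" "smooth_on U f" "v \<in> Basis" "w \<in> Basis"
  shows "dir_deriv v (dir_deriv w f) x = dir_deriv w (dir_deriv v f) x"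
proof (rule ccontr)
  let ?F = "dir_deriv w (dir_deriv v f)" and ?G = "dir_deriv v (dir_deriv w f)"
  assume ne: "?G x \<noteq> ?F x"
  \<comment> \<open>Half of the gap, so that two strict \<open>e\<close>-estimates around a common
    value are contradictory.\<close>
  define e where "e = \<bar>?G x - ?F x\<bar> / 2"
  have "e > 0" using ne by (simp add: e_def)
  have "isCont ?F x" "isCont ?G x"
    using assms(2) smooth_on_continuous[OF smooth_on_dir_deriv[OF smooth_on_dir_deriv[OF assms(3)]]]
    by (simp_all add: continuous_on_eq_continuous_at[OF assms(1)] assms(4,5))
  then obtain d1 d2 where d: "d1 > 0" "d2 > 0"
    "\<And>y. dist y x < d1 \<Longrightarrow> dist (?F y) (?F x) < e"
    "\<And>y. dist y x < d2 \<Longrightarrow> dist (?G y) (?G x) < e"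
    using \<open>e > 0\<close> unfolding continuous_at_eps_delta by metis
  obtain d3 where d3: "d3 > 0" "ball x d3 \<subseteq> U"
    using assms(1,2) openE by blast
  \<comment> \<open>The parallelogram of side \<open>h\<close> lies within distance
    \<open>2 * h\<close> of \<open>x\<close>; a third of the smallest radius keeps this below all
    three radii.\<close>
  define h where "h = Min {d1, d2, d3} / 3"
  have h: "h > 0" "2 * h < d1" "2 * h < d2" "2 * h < d3"
    using d d3 by (auto simp: h_def)
  have near: "dist (x + s *\<^sub>R a + t *\<^sub>R b) x \<le> 2 * h"
    if "0 \<le> s" "s \<le> h" "0 \<le> t" "t \<le> h" "a \<in> Basis" "b \<in> Basis" for s t and a b :: 'a
  proof -
    have "dist (x + s *\<^sub>R a + t *\<^sub>R b) x = norm (s *\<^sub>R a + t *\<^sub>R b)"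
      by (simp add: dist_norm)
    also have "\<dots> \<le> norm (s *\<^sub>R a) + norm (t *\<^sub>R b)" by (rule norm_triangle_ineq)
    also have "\<dots> = s + t" using that by simp
    finally show ?thesis using that by linarith
  qed
  have inU: "x + s *\<^sub>R a + t *\<^sub>R b \<in> U"
    if "0 \<le> s" "s \<le> h" "0 \<le> t" "t \<le> h" "a \<in> Basis" "b \<in> Basis" for s t and a b :: 'a
    using near[OF that] h(4) d3(2) by (auto simp: dist_commute subset_iff)
  obtain s t where st: "0 < s" "s < h" "0 < t" "t < h"
    "f (x + h *\<^sub>R v + h *\<^sub>R w) - f (x + h *\<^sub>R v) - f (x + h *\<^sub>R w) + f x
      = h * h * ?F (x + s *\<^sub>R v + t *\<^sub>R w)"
    using second_difference_mean_value[of h f x v w, OF h(1)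
      smooth_on_differentiable[OF assms(3) inU]
      smooth_on_differentiable[OF smooth_on_dir_deriv[OF assms(3)] inU]] assms(4,5) by blast
  obtain s' t' where st': "0 < s'" "s' < h" "0 < t'" "t' < h"
    "f (x + h *\<^sub>R w + h *\<^sub>R v) - f (x + h *\<^sub>R w) - f (x + h *\<^sub>R v) + f x
      = h * h * ?G (x + s' *\<^sub>R w + t' *\<^sub>R v)"
    using second_difference_mean_value[of h f x w v, OF h(1)
      smooth_on_differentiable[OF assms(3) inU]
      smooth_on_differentiable[OF smooth_on_dir_deriv[OF assms(3)] inU]] assms(4,5) by blast
  have "h * h * ?F (x + s *\<^sub>R v + t *\<^sub>R w) = h * h * ?G (x + s' *\<^sub>R w + t' *\<^sub>R v)"
    using st(5) st'(5) by (simp add: algebra_simps)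
  then have "?F (x + s *\<^sub>R v + t *\<^sub>R w) = ?G (x + s' *\<^sub>R w + t' *\<^sub>R v)"
    using h(1) by simp
  moreover have "dist (?F (x + s *\<^sub>R v + t *\<^sub>R w)) (?F x) < e"
    using near[of s t v w] st h assms by (intro d) linarith
  moreover have "dist (?G (x + s' *\<^sub>R w + t' *\<^sub>R v)) (?G x) < e"
    using near[of s' t' w v] st' h assms by (intro d) linarith
  ultimately show False
    by (simp add: e_def dist_real_def abs_if split: if_splits)
qed

section \<open>Derivatives along multi-indices\<close>

lemma smooth_on_pd: "smooth_on U f \<Longrightarrow> smooth_on U (pd i f)"
  by (simp add: smooth_on_dir_deriv)

lemma smooth_on_funpow_pd: "smooth_on U f \<Longrightarrow> smooth_on U ((pd i ^^ n) f)"
  by (induction n) (simp_all add: smooth_on_pd)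

lemma funpow_pd_cong:
  assumes "open U" "\<And>y. y \<in> U \<Longrightarrow> f y = g y"
  shows "x \<in> U \<Longrightarrow> (pd i ^^ n) f x = (pd i ^^ n) g x"
proof (induction n arbitrary: x)
  case (Suc n)
  then show ?case using dir_deriv_cong[OF assms(1) Suc.prems Suc.IH] by simp
qed (use assms in auto)

lemma pd_funpow_commute:
  assumes "open U" "smooth_on U f"
  shows "x \<in> U \<Longrightarrow> pd j ((pd i ^^ n) f) x = (pd i ^^ n) (pd j f) x"
proof (induction n arbitrary: x)
  case (Suc n)
  have "pd j ((pd i ^^ Suc n) f) x = pd i (pd j ((pd i ^^ n) f)) x"
    using dir_deriv_commute[OF assms(1) Suc.prems smooth_on_funpow_pd[OF assms(2)]] by simp
  also have "\<dots> = pd i ((pd i ^^ n) (pd j f)) x"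
    by (rule dir_deriv_cong[OF assms(1) Suc.prems Suc.IH])
  finally show ?case by simp
qed auto

lemma smooth_on_multi_deriv: "smooth_on U f \<Longrightarrow> smooth_on U (multi_deriv \<sigma> f)"
  by (simp add: multi_deriv_def smooth_on_funpow_pd)

text \<open>\<open>multi_deriv\<close> differentiates in a fixed order of the indices, so the new
  \<open>pd k\<close> is moved inward past the blocks of smaller index until it joins its own
  block.\<close>

lemma pd_multi_deriv:
  assumes U: "open U" "smooth_on U f" and x: "x \<in> U"
  shows "pd k (multi_deriv \<sigma> f) x = multi_deriv (add_mset k \<sigma>) f x"
proof -
  consider "k = 1" | "k = 2" | "k = 3" | "k = 4" using exhaust_4[of k] by blast
  then show ?thesis
    by cases (auto simp: multi_deriv_def U x pd_funpow_commute[OF U(1)] smooth_on_funpow_pd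
      intro!: funpow_pd_cong[OF U(1)])
qed

section \<open>Differentiation rules\<close>

lemma dir_deriv_add:
  "f differentiable (at x) \<Longrightarrow> g differentiable (at x) \<Longrightarrow>
    dir_deriv v (\<lambda>y. f y + g y) x = dir_deriv v f x + dir_deriv v g x"
  by (rule dir_deriv_eq) (auto intro!: derivative_eq_intros has_derivative_dir_deriv)

lemma dir_deriv_diff:
  "f differentiable (at x) \<Longrightarrow> g differentiable (at x) \<Longrightarrow>
    dir_deriv v (\<lambda>y. f y - g y) x = dir_deriv v f x - dir_deriv v g x"
  by (rule dir_deriv_eq) (auto intro!: derivative_eq_intros has_derivative_dir_deriv)

lemma dir_deriv_mult:
  "f differentiable (at x) \<Longrightarrow> g differentiable (at x) \<Longrightarrow>
    dir_deriv v (\<lambda>y. f y * g y) x = dir_deriv v f x * g x + f x * dir_deriv v g x"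
  by (rule dir_deriv_eq) (auto intro!: derivative_eq_intros has_derivative_dir_deriv)

lemma dir_deriv_divide:
  "f differentiable (at x) \<Longrightarrow> g differentiable (at x) \<Longrightarrow> g x \<noteq> 0 \<Longrightarrow>
    dir_deriv v (\<lambda>y. f y / g y) x = (dir_deriv v f x * g x - f x * dir_deriv v g x) / (g x * g x)"
  by (rule dir_deriv_eq) (auto intro!: derivative_eq_intros has_derivative_dir_deriv)

lemma dir_deriv_const: "dir_deriv v (\<lambda>y. c) x = 0"
  by (rule dir_deriv_eq) (auto intro!: derivative_eq_intros)

text \<open>The chain rule for coefficients depending on two scalar functions, such as
  \<open>q (x$3, x$4)\<close> or \<open>Q (x$4, p {#4#})\<close>.\<close>

lemma dir_deriv_compose_Pair:
  fixes f g :: "'a::euclidean_space \<Rightarrow> real"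
  assumes "f differentiable (at x)" "g differentiable (at x)" "h differentiable (at (f x, g x))"
  shows "(\<lambda>y. h (f y, g y)) differentiable (at x)"
    and "dir_deriv v (\<lambda>y. h (f y, g y)) x
      = dir_deriv (1, 0) h (f x, g x) * dir_deriv v f x
        + dir_deriv (0, 1) h (f x, g x) * dir_deriv v g x"
proof -
  have "((\<lambda>y. h (f y, g y)) has_derivative
      (\<lambda>v. dir_deriv (dir_deriv v f x, dir_deriv v g x) h (f x, g x))) (at x)"
    by (rule has_derivative_compose[where g = h and f = "\<lambda>y. (f y, g y)"
          and f' = "\<lambda>v. (dir_deriv v f x, dir_deriv v g x)"])
       (auto intro!: has_derivative_Pair has_derivative_dir_deriv assms)
  note * = this
  show "(\<lambda>y. h (f y, g y)) differentiable (at x)"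
    using * unfolding differentiable_def by blast
  have lin: "linear (\<lambda>v. dir_deriv v h (f x, g x))"
    by (rule has_derivative_linear[OF has_derivative_dir_deriv[OF assms(3)]])
  have "(dir_deriv v f x, dir_deriv v g x)
      = dir_deriv v f x *\<^sub>R (1, 0) + dir_deriv v g x *\<^sub>R (0, 1)"
    by simp
  then have "dir_deriv (dir_deriv v f x, dir_deriv v g x) h (f x, g x)
      = dir_deriv v f x *\<^sub>R dir_deriv (1, 0) h (f x, g x)
        + dir_deriv v g x *\<^sub>R dir_deriv (0, 1) h (f x, g x)"
    using linear_add[OF lin] linear_cmul[OF lin] by metis
  then show "dir_deriv v (\<lambda>y. h (f y, g y)) x
      = dir_deriv (1, 0) h (f x, g x) * dir_deriv v f x
        + dir_deriv (0, 1) h (f x, g x) * dir_deriv v g x"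
    using dir_deriv_eq[OF *, of v] by simp
qed

lemma pd_nth: "pd k (\<lambda>y. y $ i) x = (if k = i then 1 else 0)"
proof -
  have "pd k (\<lambda>y. y $ i) x = axis k 1 $ i"
    by (rule dir_deriv_eq[where f' = "\<lambda>v. v $ i"])
       (rule bounded_linear_imp_has_derivative[OF bounded_linear_vec_nth])
  then show ?thesis by (auto simp: axis_def)
qed

lemma differentiable_nth: "(\<lambda>y. y $ i) differentiable (at (x :: real^4))"
  unfolding differentiable_def
  using bounded_linear_imp_has_derivative[OF bounded_linear_vec_nth] by blast

lemma
  assumes "open U" "smooth_on U u" "x \<in> U"
  shows differentiable_jet_of: "(\<lambda>y. jet_of u y \<sigma>) differentiable (at x)"
    and pd_jet_of: "pd k (\<lambda>y. jet_of u y \<sigma>) x = jet_of u x (add_mset k \<sigma>)"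
  using smooth_on_differentiable[OF smooth_on_multi_deriv[OF assms(2)] assms(3)]
    pd_multi_deriv[OF assms]
  by (simp_all add: jet_of_def)

section \<open>Differentials on jets\<close>

text \<open>\<open>l\<close> is the differential of \<open>G\<close> at \<open>p\<close> applied to
  \<open>r\<close>, counting coordinates of order at most \<open>n\<close>: order 2 gives the
  linearization, order 1 the jet part of a total derivative. Differentiability in each coordinate is
  recorded because \<open>jet_partial\<close> is built on \<open>deriv\<close>, whose sum and
  product rules require it.\<close>

definition has_jet_diff :: "nat \<Rightarrow> (jet \<Rightarrow> real) \<Rightarrow> jet \<Rightarrow> jet \<Rightarrow> real \<Rightarrow> bool" where
  "has_jet_diff n G p r l \<longleftrightarrow>
     (\<forall>\<sigma>. (\<lambda>a. G (p(\<sigma> := a))) field_differentiable (at (p \<sigma>))) \<and>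
     (\<Sum>\<sigma> | size \<sigma> \<le> n. jet_partial \<sigma> G p * r \<sigma>) = l"

lemma has_jet_diff_const: "has_jet_diff n (\<lambda>p. c) p r 0"
  by (simp add: has_jet_diff_def jet_partial_def)

lemma has_jet_diff_coord:
  assumes "size \<tau> \<le> n"
  shows "has_jet_diff n (\<lambda>p. p \<tau>) p r (r \<tau>)"
proof -
  have "(\<lambda>a. (p(\<sigma> := a)) \<tau>) = (if \<sigma> = \<tau> then (\<lambda>a. a) else (\<lambda>a. p \<tau>))" for \<sigma>
    by auto
  moreover from this have "jet_partial \<sigma> (\<lambda>p. p \<tau>) p * r \<sigma> = (if \<sigma> = \<tau> then r \<sigma> else 0)" for \<sigma>
    unfolding jet_partial_def by simp
  ultimately show ?thesis
    using assms by (simp add: has_jet_diff_def finite_multi_indices)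
qed

lemma has_jet_diff_add:
  assumes "has_jet_diff n G p r l" "has_jet_diff n H p r m"
  shows "has_jet_diff n (\<lambda>p. G p + H p) p r (l + m)"
  using assms unfolding has_jet_diff_def jet_partial_def
  by (auto intro!: field_differentiable_add simp: sum.distrib distrib_right)

lemma has_jet_diff_diff:
  assumes "has_jet_diff n G p r l" "has_jet_diff n H p r m"
  shows "has_jet_diff n (\<lambda>p. G p - H p) p r (l - m)"
  using assms unfolding has_jet_diff_def jet_partial_def
  by (auto intro!: field_differentiable_diff simp: sum_subtractf left_diff_distrib)

lemma has_jet_diff_mult:
  assumes "has_jet_diff n G p r l" "has_jet_diff n H p r m"
  shows "has_jet_diff n (\<lambda>p. G p * H p) p r (l * H p + G p * m)"
proof -
  have "jet_partial \<sigma> (\<lambda>p. G p * H p) p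
      = jet_partial \<sigma> G p * H p + G p * jet_partial \<sigma> H p" for \<sigma>
    using assms by (simp add: has_jet_diff_def jet_partial_def)
  then have "(\<Sum>\<sigma> | size \<sigma> \<le> n. jet_partial \<sigma> (\<lambda>p. G p * H p) p * r \<sigma>)
      = (\<Sum>\<sigma> | size \<sigma> \<le> n. jet_partial \<sigma> G p * r \<sigma>) * H p
        + G p * (\<Sum>\<sigma> | size \<sigma> \<le> n. jet_partial \<sigma> H p * r \<sigma>)"
    by (simp add: sum_distrib_left sum_distrib_right sum.distrib[symmetric] algebra_simps)
  then show ?thesis
    using assms unfolding has_jet_diff_def by (auto intro!: field_differentiable_mult)
qed

text \<open>Serves for reciprocals and for \<open>Q\<close> as a function of its second
  argument.\<close>

lemma has_jet_diff_compose:
  assumes "has_jet_diff n G p r l" "(h has_real_derivative h') (at (G p))"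
  shows "has_jet_diff n (\<lambda>p. h (G p)) p r (h' * l)"
proof -
  have *: "((\<lambda>a. h (G (p(\<sigma> := a)))) has_real_derivative h' * jet_partial \<sigma> G p) (at (p \<sigma>))" for \<sigma>
    using assms(1) unfolding has_jet_diff_def jet_partial_def
    by (intro DERIV_chain2[where f = h]) (use assms(2) in \<open>auto simp: field_differentiable_derivI\<close>)
  then have "jet_partial \<sigma> (\<lambda>p. h (G p)) p = h' * jet_partial \<sigma> G p" for \<sigma>
    unfolding jet_partial_def[of \<sigma> "\<lambda>p. h (G p)"] by (rule DERIV_imp_deriv)
  then have "(\<Sum>\<sigma> | size \<sigma> \<le> n. jet_partial \<sigma> (\<lambda>p. h (G p)) p * r \<sigma>)
      = h' * (\<Sum>\<sigma> | size \<sigma> \<le> n. jet_partial \<sigma> G p * r \<sigma>)"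
    by (simp add: sum_distrib_left mult.assoc)
  with * show ?thesis
    using assms(1) unfolding has_jet_diff_def field_differentiable_def by auto
qed

lemma has_jet_diff_divide:
  assumes "has_jet_diff n G p r l" "has_jet_diff n H p r m" "H p \<noteq> 0"
  shows "has_jet_diff n (\<lambda>p. G p / H p) p r ((l * H p - G p * m) / (H p * H p))"
proof -
  have "has_jet_diff n (\<lambda>p. inverse (H p)) p r (- inverse (H p * H p) * m)"
    by (rule has_jet_diff_compose[OF assms(2)])
       (use assms(3) in \<open>auto intro!: derivative_eq_intros simp: power2_eq_square\<close>)
  from has_jet_diff_mult[OF assms(1) this] show ?thesis
    using assms(3) by (simp add: divide_inverse algebra_simps)
qed

lemma linearization_eq:
  "has_jet_diff 2 (F x) (jet_of u x) (jet_of \<phi> x) l \<Longrightarrow> linearization F u \<phi> x = l"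
  by (simp add: linearization_def has_jet_diff_def jet_of_def)

section \<open>Total derivatives\<close>

text \<open>
  The last clause is the chain rule for the \<open>G\<close> under consideration. It is part of the definition
  because it is inherited by sums, products and quotients, so that no joint differentiability in
  the point and the jet has to be assumed.
\<close>

definition has_total_derivs ::
    "(real^4) set \<Rightarrow> real^4 \<Rightarrow> (real^4 \<Rightarrow> jet \<Rightarrow> real) \<Rightarrow> (4 \<Rightarrow> jet \<Rightarrow> real) \<Rightarrow> bool" where
  "has_total_derivs U x G D \<longleftrightarrow>
     (\<forall>s. (\<lambda>y. G y s) differentiable (at x)) \<and>
     (\<forall>k s. has_jet_diff 1 (G x) s (\<lambda>\<sigma>. s (add_mset k \<sigma>)) (D k s - pd k (\<lambda>y. G y s) x)) \<and>
     (\<forall>\<psi>. smooth_on U \<psi> \<longrightarrow> (\<lambda>y. G y (jet_of \<psi> y)) differentiable (at x) \<and>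
        (\<forall>k. pd k (\<lambda>y. G y (jet_of \<psi> y)) x = D k (jet_of \<psi> x)))"

lemma total_deriv_eq: "has_total_derivs U x G D \<Longrightarrow> total_deriv k G x s = D k s"
  by (simp add: has_total_derivs_def has_jet_diff_def total_deriv_def)

lemma pd_along_solution:
  "has_total_derivs U x G D \<Longrightarrow> smooth_on U \<psi> \<Longrightarrow>
    pd k (\<lambda>y. G y (jet_of \<psi> y)) x = total_deriv k G x (jet_of \<psi> x)"
  using total_deriv_eq[of U x G D k "jet_of \<psi> x"] by (simp add: has_total_derivs_def)

lemma has_total_derivs_fun:
  assumes "f differentiable (at x)"
  shows "has_total_derivs U x (\<lambda>y s. f y) (\<lambda>k s. pd k f x)"
  using assms by (simp add: has_total_derivs_def has_jet_diff_const)

lemma has_total_derivs_const: "has_total_derivs U x (\<lambda>y s. c) (\<lambda>k s. 0)"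
  using has_total_derivs_fun[of "\<lambda>y. c"] by (simp add: dir_deriv_const)

text \<open>With \<open>u\<close> (or \<open>\<phi>\<close>) fixed, its jet coordinates depend on
  the point alone; the total derivative is then the ordinary partial derivative, which adds an
  index.\<close>

lemma has_total_derivs_jet_of:
  assumes "open U" "smooth_on U u" "x \<in> U"
  shows "has_total_derivs U x (\<lambda>y s. jet_of u y \<sigma>) (\<lambda>k s. jet_of u x (add_mset k \<sigma>))"
  using has_total_derivs_fun[OF differentiable_jet_of[OF assms]]
  by (simp add: pd_jet_of[OF assms])

lemma has_total_derivs_coord:
  assumes "open U" "x \<in> U"
  shows "has_total_derivs U x (\<lambda>y s. s {#i#}) (\<lambda>k s. s {#k, i#})"
proof -
  have "has_jet_diff 1 (\<lambda>s. s {#i#}) s (\<lambda>\<sigma>. s (add_mset k \<sigma>)) (s {#k, i#} - pd k (\<lambda>y. s {#i#}) x)"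
    for k s
    using has_jet_diff_coord[of "{#i#}" 1 s "\<lambda>\<sigma>. s (add_mset k \<sigma>)"]
    by (simp add: dir_deriv_const)
  with assms show ?thesis
    by (simp add: has_total_derivs_def differentiable_jet_of pd_jet_of)
qed

lemma has_total_derivs_add:
  assumes "has_total_derivs U x G D" "has_total_derivs U x H E"
  shows "has_total_derivs U x (\<lambda>y s. G y s + H y s) (\<lambda>k s. D k s + E k s)"
proof -
  have "has_jet_diff 1 (\<lambda>s. G x s + H x s) s (\<lambda>\<sigma>. s (add_mset k \<sigma>))
      ((D k s - pd k (\<lambda>y. G y s) x) + (E k s - pd k (\<lambda>y. H y s) x))" for k s
    using assms by (intro has_jet_diff_add) (auto simp: has_total_derivs_def)
  with assms show ?thesis by (simp add: has_total_derivs_def dir_deriv_add algebra_simps)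
qed

lemma has_total_derivs_diff:
  assumes "has_total_derivs U x G D" "has_total_derivs U x H E"
  shows "has_total_derivs U x (\<lambda>y s. G y s - H y s) (\<lambda>k s. D k s - E k s)"
proof -
  have "has_jet_diff 1 (\<lambda>s. G x s - H x s) s (\<lambda>\<sigma>. s (add_mset k \<sigma>))
      ((D k s - pd k (\<lambda>y. G y s) x) - (E k s - pd k (\<lambda>y. H y s) x))" for k s
    using assms by (intro has_jet_diff_diff) (auto simp: has_total_derivs_def)
  with assms show ?thesis by (simp add: has_total_derivs_def dir_deriv_diff algebra_simps)
qed

lemma has_total_derivs_mult:
  assumes "has_total_derivs U x G D" "has_total_derivs U x H E"
  shows "has_total_derivs U x (\<lambda>y s. G y s * H y s) (\<lambda>k s. D k s * H x s + G x s * E k s)"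
proof -
  have "has_jet_diff 1 (\<lambda>s. G x s * H x s) s (\<lambda>\<sigma>. s (add_mset k \<sigma>))
      ((D k s - pd k (\<lambda>y. G y s) x) * H x s + G x s * (E k s - pd k (\<lambda>y. H y s) x))" for k s
    using assms by (intro has_jet_diff_mult) (auto simp: has_total_derivs_def)
  with assms show ?thesis by (simp add: has_total_derivs_def dir_deriv_mult algebra_simps)
qed

text \<open>Nonvanishing for every \<open>s\<close> is the right hypothesis, as the denominators in
  the relations do not involve the jet of \<open>\<psi>\<close>.\<close>

lemma has_total_derivs_divide:
  assumes "has_total_derivs U x G D" "has_total_derivs U x H E" "\<And>s. H x s \<noteq> 0"
  shows "has_total_derivs U x (\<lambda>y s. G y s / H y s)
    (\<lambda>k s. (D k s * H x s - G x s * E k s) / (H x s * H x s))"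
proof -
  have "has_jet_diff 1 (\<lambda>s. G x s / H x s) s (\<lambda>\<sigma>. s (add_mset k \<sigma>))
      (((D k s - pd k (\<lambda>y. G y s) x) * H x s - G x s * (E k s - pd k (\<lambda>y. H y s) x))
        / (H x s * H x s))" for k s
    using assms by (intro has_jet_diff_divide) (auto simp: has_total_derivs_def)
  moreover have "((D k s - pd k (\<lambda>y. G y s) x) * H x s - G x s * (E k s - pd k (\<lambda>y. H y s) x))
        / (H x s * H x s)
      = (D k s * H x s - G x s * E k s) / (H x s * H x s) - pd k (\<lambda>y. G y s / H y s) x" for k s
    using assms by (simp add: has_total_derivs_def dir_deriv_divide diff_divide_distrib
        left_diff_distrib right_diff_distrib)
  ultimately show ?thesis
    using assms by (simp add: has_total_derivs_def dir_deriv_divide)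
qed

lemma has_total_derivs_compose_Pair:
  assumes "has_total_derivs U x (\<lambda>y s. f y) D" "has_total_derivs U x (\<lambda>y s. g y) E"
    and "h differentiable (at (f x, g x))"
  shows "has_total_derivs U x (\<lambda>y s. h (f y, g y))
    (\<lambda>k s. dir_deriv (1, 0) h (f x, g x) * D k s + dir_deriv (0, 1) h (f x, g x) * E k s)"
proof -
  have "f differentiable (at x)" "g differentiable (at x)"
    using assms(1,2) by (simp_all add: has_total_derivs_def)
  \<comment> \<open>Total derivatives are unique, so for functions of the point alone
    \<open>D\<close> and \<open>E\<close> must be the partial derivatives.\<close>
  moreover have "D k s = pd k f x" "E k s = pd k g x" for k s
    using total_deriv_eq[OF assms(1)] total_deriv_eq[OF assms(2)]
      total_deriv_eq[OF has_total_derivs_fun[of f x U]] total_deriv_eq[OF has_total_derivs_fun[of g x U]]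
      calculation by metis+
  ultimately show ?thesis
    using has_total_derivs_fun[OF dir_deriv_compose_Pair(1), of f x g h U] assms(3)
    by (simp add: dir_deriv_compose_Pair(2))
qed

lemma has_total_derivs_nth:
  "has_total_derivs U x (\<lambda>y s. y $ i) (\<lambda>k s. if k = i then 1 else 0)"
  using has_total_derivs_fun[OF differentiable_nth] by (simp add: pd_nth)

lemma total_deriv_cong:
  assumes "open U" "x \<in> U" "\<forall>y\<in>U. \<forall>s. G y s = H y s"
  shows "total_deriv k G x s = total_deriv k H x s"
proof -
  have "G x = H x" using assms by auto
  moreover have "pd k (\<lambda>y. G y s) x = pd k (\<lambda>y. H y s) x"
    using assms by (intro dir_deriv_cong) auto
  ultimately show ?thesis by (simp add: total_deriv_def)
qed

text \<open>The device for differentiating a relation: an identity valid on \<open>U\<close> and for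
  all jets yields an equation between the total derivatives of its sides, each computed by its own
  rules.\<close>

lemma has_total_derivs_unique:
  assumes "open U" "x \<in> U" "has_total_derivs U x G D" "has_total_derivs U x H E"
    and "\<forall>y\<in>U. \<forall>s. G y s = H y s"
  shows "D k s = E k s"
  using total_deriv_cong[OF assms(1,2,5)] total_deriv_eq[OF assms(3)] total_deriv_eq[OF assms(4)]
  by metis

text \<open>Replaces an explicit total derivative by the term \<open>total_deriv k G x s\<close>, so
  that derivatives of the right-hand sides of the relations remain atoms in polynomial
  computations.\<close>

lemma has_total_derivs_total_deriv:
  "has_total_derivs U x G D \<Longrightarrow> has_total_derivs U x G (\<lambda>k s. total_deriv k G x s)"
  using total_deriv_eq[of U x G D] by simp

lemmas has_total_derivs_intros =
  has_total_derivs_add has_total_derivs_diff has_total_derivs_mult has_total_derivs_divide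
  has_total_derivs_const

lemmas has_jet_diff_intros =
  has_jet_diff_add has_jet_diff_diff has_jet_diff_mult has_jet_diff_coord has_jet_diff_const

section \<open>Reduction to identities between jets at a point\<close>

definition prolongs ::
    "4 set \<Rightarrow> 4 \<Rightarrow> 4 \<Rightarrow> (real^4 \<Rightarrow> jet \<Rightarrow> real) \<Rightarrow>
      (real^4 \<Rightarrow> jet \<Rightarrow> real) \<Rightarrow> real^4 \<Rightarrow> jet \<Rightarrow> bool" where
  "prolongs K i j A B x s \<longleftrightarrow> s {#i#} = A x s \<and> s {#j#} = B x s \<and>
     (\<forall>k\<in>K. s {#i, k#} = total_deriv k A x s \<and> s {#j, k#} = total_deriv k B x s)"

lemma prolongsD:
  assumes "prolongs K i j A B x s"
  shows "s {#i#} = A x s" "s {#j#} = B x s"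
    and "k \<in> K \<Longrightarrow> s {#i, k#} = total_deriv k A x s"
    and "k \<in> K \<Longrightarrow> s {#j, k#} = total_deriv k B x s"
  using assms by (simp_all add: prolongs_def)

text \<open>Both requirements become statements about a single jet \<open>s\<close> at a point. The
  set \<open>K\<close> of \<open>prolongs\<close> distinguishes them: \<open>- {i, j}\<close> gives
  the constraints in \<open>compatible\<close>, while \<open>UNIV\<close> describes the jets of
  actual solutions.\<close>

lemma recursion_operator_pairI:
  assumes "i \<noteq> j"
    and step: "\<And>U u \<phi> x A' B'.
      \<lbrakk>open U; x \<in> U; smooth_on U u; smooth_on U \<phi>;
        \<And>y. y \<in> U \<Longrightarrow> F y (jet_of u y) = 0; \<And>y. y \<in> U \<Longrightarrow> (y, jet_of u y) \<in> \<Omega>;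
        linearization F u \<phi> x = 0;
        A' = (\<lambda>y s. A y (jet_of u y) (jet_of \<phi> y) s); B' = (\<lambda>y s. B y (jet_of u y) (jet_of \<phi> y) s)\<rbrakk>
      \<Longrightarrow> (\<exists>D. has_total_derivs U x A' D) \<and> (\<exists>D. has_total_derivs U x B' D) \<and>
        (\<forall>s. prolongs (- {i, j}) i j A' B' x s \<longrightarrow> total_deriv j A' x s = total_deriv i B' x s) \<and>
        (\<forall>s. prolongs UNIV i j A' B' x s \<longrightarrow> has_jet_diff 2 (F x) (jet_of u x) s 0)"
  shows "recursion_operator \<Omega> F {(i, A), (j, B)}"
  unfolding recursion_operator_def
proof (intro allI impI)
  fix U u \<phi>
  assume U: "open U" "solves U F u" "\<forall>x\<in>U. (x, jet_of u x) \<in> \<Omega>" "solves_linearized U F u \<phi>"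
  define A' where "A' = (\<lambda>y s. A y (jet_of u y) (jet_of \<phi> y) s)"
  define B' where "B' = (\<lambda>y s. B y (jet_of u y) (jet_of \<phi> y) s)"
  have S: "system_over {(i, A), (j, B)} u \<phi> = {(i, A'), (j, B')}"
    by (simp add: system_over_def A'_def B'_def)
  have sm: "smooth_on U u" "smooth_on U \<phi>" and F: "\<And>y. y \<in> U \<Longrightarrow> F y (jet_of u y) = 0"
    and L: "\<And>y. y \<in> U \<Longrightarrow> linearization F u \<phi> y = 0"
    using U by (auto simp: solves_def solves_linearized_def)
  have st: "\<exists>D. has_total_derivs U x A' D" "\<exists>D. has_total_derivs U x B' D"
      "\<And>s. prolongs (- {i, j}) i j A' B' x s \<Longrightarrow> total_deriv j A' x s = total_deriv i B' x s"
      "\<And>s. prolongs UNIV i j A' B' x s \<Longrightarrow> has_jet_diff 2 (F x) (jet_of u x) s 0"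
    if "x \<in> U" for x
    using step[OF U(1) that sm F _ L[OF that] A'_def B'_def] U(3) by simp_all
  \<comment> \<open>Pairing a relation with itself gives a trivial equation; only the mixed pair has
    content.\<close>
  have "compatible U {(i, A'), (j, B')}"
    unfolding compatible_def using st(3) by (auto simp: prolongs_def)
  moreover have "solves_linearized U F u \<psi>" if \<psi>: "solves_system U {(i, A'), (j, B')} \<psi>" for \<psi>
  proof -
    have sm\<psi>: "smooth_on U \<psi>"
      and eq: "\<And>y. y \<in> U \<Longrightarrow> pd i \<psi> y = A' y (jet_of \<psi> y)" "\<And>y. y \<in> U \<Longrightarrow> pd j \<psi> y = B' y (jet_of \<psi> y)"
      using \<psi> by (auto simp: solves_system_def)
    have jet1: "jet_of \<psi> y {#k#} = pd k \<psi> y" if "y \<in> U" for k y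
      using pd_multi_deriv[OF U(1) sm\<psi> that, of k "{#}"] by (simp add: jet_of_def multi_deriv_def)
    \<comment> \<open>On a solution the relation holds throughout the open set and may be
      differentiated in every direction, so the jet of \<open>\<psi>\<close> satisfies
      \<open>prolongs UNIV\<close>.\<close>
    have jet2: "jet_of \<psi> x {#m, k#} = total_deriv k G x (jet_of \<psi> x)"
      if "x \<in> U" "\<exists>D. has_total_derivs U x G D" "\<And>y. y \<in> U \<Longrightarrow> pd m \<psi> y = G y (jet_of \<psi> y)" for m k x G
    proof -
      have "jet_of \<psi> x {#m, k#} = pd k (\<lambda>y. jet_of \<psi> y {#m#}) x"
        using pd_jet_of[OF U(1) sm\<psi> that(1)] by (simp add: add_mset_commute)
      also have "\<dots> = pd k (\<lambda>y. G y (jet_of \<psi> y)) x"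
        by (rule dir_deriv_cong[OF U(1) that(1)]) (simp add: jet1 that(3))
      also have "\<dots> = total_deriv k G x (jet_of \<psi> x)"
        using that(2) pd_along_solution sm\<psi> by blast
      finally show ?thesis .
    qed
    have "linearization F u \<psi> x = 0" if "x \<in> U" for x
      using st(4)[OF that] jet2[OF that st(1)[OF that] eq(1)] jet2[OF that st(2)[OF that] eq(2)]
        jet1[OF that] eq that
      by (intro linearization_eq) (simp add: prolongs_def)
    with sm\<psi> show ?thesis by (simp add: solves_linearized_def)
  qed
  ultimately show "compatible U (system_over {(i, A), (j, B)} u \<phi>) \<and>
      (\<forall>\<psi>. solves_system U (system_over {(i, A), (j, B)} u \<phi>) \<psi> \<longrightarrow> solves_linearized U F u \<psi>)"
    unfolding S by blast
qed

lemma linearization_zeroD: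
  "linearization F u \<phi> x = 0 \<Longrightarrow> has_jet_diff 2 (F x) (jet_of u x) (jet_of \<phi> x) l \<Longrightarrow> l = 0"
  using linearization_eq by metis

lemma has_jet_diff_zeroI:
  "has_jet_diff n G p r l \<Longrightarrow> l = 0 \<Longrightarrow> has_jet_diff n G p r 0"
  by simp

section \<open>Linearizations of the four equations\<close>

lemma has_jet_diff_eq_D:
  "has_jet_diff 2 (eq_D q b x) p r
    (p {#1,4#} * r {#2,3#} + p {#2,3#} * r {#1,4#} - p {#1,3#} * r {#2,4#} - p {#2,4#} * r {#1,3#}
      - dir_deriv (1, 0) q (x$3, x$4) * r {#4#} + dir_deriv (0, 1) q (x$3, x$4) * r {#3#})"
proof -
  have "has_jet_diff 2 (eq_D q b x) p r
    ((r {#1,4#} * p {#2,3#} + p {#1,4#} * r {#2,3#}) - (r {#1,3#} * p {#2,4#} + p {#1,3#} * r {#2,4#})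
    - ((0 * p {#4#} + dir_deriv (1, 0) q (x$3, x$4) * r {#4#})
      - (0 * p {#3#} + dir_deriv (0, 1) q (x$3, x$4) * r {#3#}) + 0))"
    unfolding eq_D_def cal_Q_def by (intro has_jet_diff_intros) simp_all
  then show ?thesis by (simp add: algebra_simps)
qed

text \<open>Only the second argument of \<open>Q\<close> is a jet coordinate; \<open>t\<close> is
  held fixed, so the linearization sees just the derivative of \<open>Q\<close> in that
  argument.\<close>

lemma has_jet_diff_fun_t:
  fixes Q :: fun2
  assumes "Q differentiable (at (t, p {#4#}))"
  shows "has_jet_diff 2 (\<lambda>p. Q (t, p {#4#})) p r (dir_deriv (0, 1) Q (t, p {#4#}) * r {#4#})"
proof (rule has_jet_diff_compose[where G = "\<lambda>p. p {#4#}" and h = "\<lambda>a. Q (t, a)"])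
  show "has_jet_diff 2 (\<lambda>p. p {#4#}) p r (r {#4#})" by (rule has_jet_diff_coord) simp
  have *: "(Q has_derivative (\<lambda>v. dir_deriv v Q (t, p {#4#}))) (at (t, p {#4#}))"
    by (rule has_derivative_dir_deriv[OF assms])
  have "((\<lambda>a. Q (t, a)) has_derivative (\<lambda>v. dir_deriv (0, v) Q (t, p {#4#}))) (at (p {#4#}))"
    by (rule has_derivative_compose[where g = Q and f = "\<lambda>a. (t, a)" and f' = "\<lambda>v. (0, v)"])
       (auto intro!: has_derivative_Pair has_derivative_const has_derivative_ident *)
  moreover have "(\<lambda>v. dir_deriv (0, v) Q (t, p {#4#})) = (*) (dir_deriv (0, 1) Q (t, p {#4#}))"
  proof
    fix v show "dir_deriv (0, v) Q (t, p {#4#}) = dir_deriv (0, 1) Q (t, p {#4#}) * v"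
      using linear_cmul[OF has_derivative_linear[OF *], of v "(0, 1)"] by simp
  qed
  ultimately show "((\<lambda>a. Q (t, a)) has_real_derivative dir_deriv (0, 1) Q (t, p {#4#})) (at (p {#4#}))"
    by (simp add: has_field_derivative_def)
qed

lemma has_jet_diff_eq_III:
  assumes "Q differentiable (at (x$4, p {#4#}))"
  shows "has_jet_diff 2 (eq_III Q x) p r
    (r {#2,4#} - (r {#1,4#} * p {#3,3#} + p {#1,4#} * r {#3,3#})
      + (r {#1,3#} * p {#3,4#} + p {#1,3#} * r {#3,4#})
      - (dir_deriv (0, 1) Q (x$4, p {#4#}) * r {#4#} * p {#3,4#} + Q (x$4, p {#4#}) * r {#3,4#}))"
  unfolding eq_III_def by (intro has_jet_diff_intros has_jet_diff_fun_t assms) simp_all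

lemma has_jet_diff_eq_II:
  assumes "Q differentiable (at (x$4, p {#4#}))"
  shows "has_jet_diff 2 (eq_II Q x) p r
    ((r {#1,2#} * p {#3,4#} + p {#1,2#} * r {#3,4#}) - (r {#1,3#} * p {#2,4#} + p {#1,3#} * r {#2,4#})
      - (dir_deriv (0, 1) Q (x$4, p {#4#}) * r {#4#} * p {#1,4#} + Q (x$4, p {#4#}) * r {#1,4#}))"
  unfolding eq_II_def by (intro has_jet_diff_intros has_jet_diff_fun_t assms) simp_all

lemma has_jet_diff_eq_I:
  assumes "Q differentiable (at (x$4, p {#4#}))"
  shows "has_jet_diff 2 (eq_I Q x) p r
    ((r {#1,2#} * p {#3,4#} + p {#1,2#} * r {#3,4#}) - (r {#1,3#} * p {#2,4#} + p {#1,3#} * r {#2,4#})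
      - (dir_deriv (0, 1) Q (x$4, p {#4#}) * r {#4#} * (p {#1,2#} * p {#3,4#} - p {#1,4#} * p {#2,3#})
        + Q (x$4, p {#4#}) * ((r {#1,2#} * p {#3,4#} + p {#1,2#} * r {#3,4#})
          - (r {#1,4#} * p {#2,3#} + p {#1,4#} * r {#2,3#}))))"
  unfolding eq_I_def by (intro has_jet_diff_intros has_jet_diff_fun_t assms) simp_all

text \<open>In a total derivative both arguments vary, and the explicit dependence on
  \<open>t\<close> contributes only for \<open>k = 4\<close>.\<close>

lemma has_total_derivs_fun_t_jet:
  assumes "open U" "x \<in> U" "smooth_on U u" "Q differentiable (at (x$4, jet_of u x {#4#}))"
  shows "has_total_derivs U x (\<lambda>y s. Q (y$4, jet_of u y {#4#}))
    (\<lambda>k s. dir_deriv (1, 0) Q (x$4, jet_of u x {#4#}) * (if k = 4 then 1 else 0)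
      + dir_deriv (0, 1) Q (x$4, jet_of u x {#4#}) * jet_of u x {#k,4#})"
  by (rule has_total_derivs_compose_Pair[OF has_total_derivs_nth has_total_derivs_jet_of]) (use assms in auto)

section \<open>The four recursion operators\<close>

text \<open>The relations are Cramer's rule for the linear system \<open>id3\<close>,
  \<open>id4\<close> in \<open>\<psi>\<^sub>1\<close>, \<open>\<psi>\<^sub>2\<close>, whose
  determinant is \<open>- cal_Q\<close> by the equation for \<open>u\<close>.\<close>

lemma recursion_operator_D:
  assumes "smooth_on V q" "smooth_on V b"
  shows "recursion_operator (dom_D V q b) (eq_D q b) (rel_D q b)"
  unfolding rel_D_def
proof (rule recursion_operator_pairI)
  show "(1::4) \<noteq> 2" by simp
next
  fix U u \<phi> x and A1 A2 :: "real^4 \<Rightarrow> jet \<Rightarrow> real"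
  let ?u = "jet_of u" and ?\<phi> = "jet_of \<phi>" and ?q = "\<lambda>y::real^4. q (y$3, y$4)"
  let ?w = "\<lambda>y. cal_Q q b y (jet_of u y)"
  assume U: "open U" "x \<in> U" and sm: "smooth_on U u" "smooth_on U \<phi>"
    and F: "\<And>y. y \<in> U \<Longrightarrow> eq_D q b y (?u y) = 0"
    and dom: "\<And>y. y \<in> U \<Longrightarrow> (y, ?u y) \<in> dom_D V q b"
    and lin: "linearization (eq_D q b) u \<phi> x = 0"
    and A1: "A1 = (\<lambda>y s. 1 / ?w y * (?u y {#1,3#} * (?q y * s {#4#} + ?\<phi> y {#4#})
             - ?u y {#1,4#} * (?q y * s {#3#} + ?\<phi> y {#3#})))"
    and A2: "A2 = (\<lambda>y s. 1 / ?w y * (?u y {#2,3#} * (?q y * s {#4#} + ?\<phi> y {#4#})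
             - ?u y {#2,4#} * (?q y * s {#3#} + ?\<phi> y {#3#})))"
  have V: "(x$3, x$4) \<in> V" and w: "\<And>y. y \<in> U \<Longrightarrow> ?w y \<noteq> 0"
    using dom U by (auto simp: dom_D_def)
  have weq: "?w y = ?u y {#1,4#} * ?u y {#2,3#} - ?u y {#1,3#} * ?u y {#2,4#}" if "y \<in> U" for y
    using F[OF that] by (simp add: eq_D_def)
  note fun_zt = has_total_derivs_compose_Pair[OF has_total_derivs_nth has_total_derivs_nth, of _ x 3 4 U]
  note qd = fun_zt[OF smooth_on_differentiable[OF assms(1) V]]
  have Basis_zt: "(1::real, 0::real) \<in> Basis" "(0::real, 1::real) \<in> Basis"
    by (simp_all add: Basis_prod_def)
  note qzd = fun_zt[OF smooth_on_differentiable[OF smooth_on_dir_deriv[OF assms(1) Basis_zt(1)] V]]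
  note qtd = fun_zt[OF smooth_on_differentiable[OF smooth_on_dir_deriv[OF assms(1) Basis_zt(2)] V]]
  note bd = fun_zt[OF smooth_on_differentiable[OF assms(2) V]]
  note ud = has_total_derivs_jet_of[OF U(1) sm(1) U(2)]
  note \<phi>d = has_total_derivs_jet_of[OF U(1) sm(2) U(2)]
  note sd = has_total_derivs_coord[OF U]
  note mult = has_total_derivs_mult and diff = has_total_derivs_diff and add = has_total_derivs_add
  note wd = add[OF diff[OF mult[OF qzd ud] mult[OF qtd ud]] bd]
  have "\<exists>D. has_total_derivs U x A1 D" "\<exists>D. has_total_derivs U x A2 D"
    unfolding A1 A2 cal_Q_def
    by (rule exI, (rule has_total_derivs_intros qd qzd qtd bd ud \<phi>d sd w[OF U(2), unfolded cal_Q_def])+)+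
  then obtain D1 D2 where "has_total_derivs U x A1 D1" "has_total_derivs U x A2 D2"
    by blast
  note Ad = this[THEN has_total_derivs_total_deriv]
  have id3: "\<forall>y\<in>U. \<forall>s. ?q y * s {#3#} + ?\<phi> y {#3#}
      = ?u y {#1,3#} * A2 y s - ?u y {#2,3#} * A1 y s"
    and id4: "\<forall>y\<in>U. \<forall>s. ?q y * s {#4#} + ?\<phi> y {#4#}
      = ?u y {#1,4#} * A2 y s - ?u y {#2,4#} * A1 y s"
  proof (safe)
    fix y s assume y: "y \<in> U"
    \<comment> \<open>Inserts the factor 1 as the determinant times the reciprocal of
      \<open>?w y\<close>; both claims then become polynomial identities in this reciprocal and the
      jet coordinates.\<close>
    have inv: "1 / ?w y * ((?u y {#1,4#} * ?u y {#2,3#} - ?u y {#1,3#} * ?u y {#2,4#}) * X) = X" for X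
      using w[OF y] unfolding weq[OF y, symmetric] by simp
    show "?q y * s {#3#} + ?\<phi> y {#3#} = ?u y {#1,3#} * A2 y s - ?u y {#2,3#} * A1 y s"
      unfolding A1 A2 by (subst inv[symmetric]) algebra
    show "?q y * s {#4#} + ?\<phi> y {#4#} = ?u y {#1,4#} * A2 y s - ?u y {#2,4#} * A1 y s"
      unfolding A1 A2 by (subst inv[symmetric]) algebra
  qed
  \<comment> \<open>In the combination used for compatibility, \<open>A2\<close> and
    \<open>A1\<close> are multiplied by \<open>D\<^sub>1\<close> and \<open>- D\<^sub>2\<close> of
    this left-hand side. Differentiating the equation removes the third derivatives of
    \<open>u\<close> there, since \<open>q\<close> and \<open>b\<close> depend on \<open>z\<close>,
    \<open>t\<close> only.\<close>
  have idw: "\<forall>y\<in>U. \<forall>s::jet. ?u y {#1,4#} * ?u y {#2,3#} - ?u y {#1,3#} * ?u y {#2,4#}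
      = dir_deriv (1, 0) q (y$3, y$4) * ?u y {#4#} - dir_deriv (0, 1) q (y$3, y$4) * ?u y {#3#}
        + b (y$3, y$4)"
    using weq by (simp add: cal_Q_def)
  note t3 = has_total_derivs_unique[OF U add[OF mult[OF qd sd] \<phi>d]
      diff[OF mult[OF ud Ad(2)] mult[OF ud Ad(1)]] id3, simplified]
  note t4 = has_total_derivs_unique[OF U add[OF mult[OF qd sd] \<phi>d]
      diff[OF mult[OF ud Ad(2)] mult[OF ud Ad(1)]] id4, simplified]
  note tw = has_total_derivs_unique[OF U diff[OF mult[OF ud ud] mult[OF ud ud]] wd idw]
  \<comment> \<open>Ordered rewriting gives every multi-index one normal form, so that equal jet
    coordinates become equal atoms.\<close>
  note [simp] = add_mset_commute
  note l\<phi> = linearization_zeroD[OF lin has_jet_diff_eq_D]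
  have "total_deriv 2 A1 x s = total_deriv 1 A2 x s" if r: "prolongs (- {1, 2}) 1 2 A1 A2 x s" for s
  proof -
    have s2: "s {#1,3#} = total_deriv 3 A1 x s" "s {#1,4#} = total_deriv 4 A1 x s"
      "s {#2,3#} = total_deriv 3 A2 x s" "s {#2,4#} = total_deriv 4 A2 x s"
      using prolongsD(3,4)[OF r, of 3] prolongsD(3,4)[OF r, of 4] by simp_all
    note e = t3[of 1 s, simplified] t3[of 2 s, simplified] t3[of 4 s, simplified]
      t4[of 1 s, simplified] t4[of 2 s, simplified] t4[of 3 s, simplified]
      tw[of 1, simplified] tw[of 2, simplified] id3[rule_format, OF U(2), of s]
      id4[rule_format, OF U(2), of s]
    \<comment> \<open>\<open>u\<^sub>1\<^sub>4\<close> times \<open>D\<^sub>2\<close> of \<open>id3\<close> minus \<open>u\<^sub>2\<^sub>4\<close> times \<open>D\<^sub>1\<close> of \<open>id3\<close> plus \<open>u\<^sub>2\<^sub>3\<close> times \<open>D\<^sub>1\<close> of \<open>id4\<close> minus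
      \<open>u\<^sub>1\<^sub>3\<close> times \<open>D\<^sub>2\<close> of \<open>id4\<close> contains \<open>\<ell>\<^sub>F(\<phi>)\<close>; the terms in \<open>q\<close> reduce by \<open>D\<^sub>4\<close> of \<open>id3\<close> minus
      \<open>D\<^sub>3\<close> of \<open>id4\<close>.\<close>
    have "?w x * (total_deriv 2 A1 x s - total_deriv 1 A2 x s) = 0"
      using e[unfolded s2] l\<phi> weq[OF U(2)] by algebra
    then show ?thesis using w[OF U(2)] by simp
  qed
  moreover have "has_jet_diff 2 (eq_D q b x) (?u x) s 0" if r: "prolongs UNIV 1 2 A1 A2 x s" for s
  proof -
    have s2: "s {#1,3#} = total_deriv 3 A1 x s" "s {#1,4#} = total_deriv 4 A1 x s"
      "s {#2,3#} = total_deriv 3 A2 x s" "s {#2,4#} = total_deriv 4 A2 x s"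
      using prolongsD(3,4)[OF r, of 3] prolongsD(3,4)[OF r, of 4] by simp_all
    \<comment> \<open>\<open>D\<^sub>4\<close> of \<open>id3\<close> minus \<open>D\<^sub>3\<close> of \<open>id4\<close>\<close>
    show ?thesis
      by (rule has_jet_diff_zeroI[OF has_jet_diff_eq_D])
        (use t3[of 4 s, simplified] t4[of 3 s, simplified] s2 in algebra)
  qed
  ultimately show "(\<exists>D. has_total_derivs U x A1 D) \<and> (\<exists>D. has_total_derivs U x A2 D) \<and>
      (\<forall>s. prolongs (- {1, 2}) 1 2 A1 A2 x s \<longrightarrow> total_deriv 2 A1 x s = total_deriv 1 A2 x s) \<and>
      (\<forall>s. prolongs UNIV 1 2 A1 A2 x s \<longrightarrow> has_jet_diff 2 (eq_D q b x) (?u x) s 0)"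
    using Ad by blast
qed

lemma recursion_operator_III:
  assumes "smooth_on W Q"
  shows "recursion_operator (dom_III W) (eq_III Q) (rel_III Q)"
  unfolding rel_III_def
proof (rule recursion_operator_pairI)
  show "(3::4) \<noteq> 4" by simp
next
  fix U u \<phi> x and A3 A4 :: "real^4 \<Rightarrow> jet \<Rightarrow> real"
  let ?u = "jet_of u" and ?\<phi> = "jet_of \<phi>" and ?Q = "\<lambda>y. Q (y$4, jet_of u y {#4#})"
  assume U: "open U" "x \<in> U" and sm: "smooth_on U u" "smooth_on U \<phi>"
    and F: "\<And>y. y \<in> U \<Longrightarrow> eq_III Q y (?u y) = 0"
    and dom: "\<And>y. y \<in> U \<Longrightarrow> (y, ?u y) \<in> dom_III W"
    and lin: "linearization (eq_III Q) u \<phi> x = 0"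
    and A3: "A3 = (\<lambda>y s. ?u y {#3,3#} * ?\<phi> y {#1#} - ?\<phi> y {#2#} - ?u y {#1,3#} * ?\<phi> y {#3#})"
    and A4: "A4 = (\<lambda>y s. ?u y {#3,4#} * ?\<phi> y {#1#} - ?u y {#1,4#} * ?\<phi> y {#3#} - ?Q y * ?\<phi> y {#4#})"
  have Q: "Q differentiable (at (x$4, ?u x {#4#}))"
    using smooth_on_differentiable[OF assms] dom[OF U(2)] by (simp add: dom_III_def)
  note Qd = has_total_derivs_fun_t_jet[OF U sm(1) Q]
  note ud = has_total_derivs_jet_of[OF U(1) sm(1) U(2)]
  note \<phi>d = has_total_derivs_jet_of[OF U(1) sm(2) U(2)]
  have "\<exists>D. has_total_derivs U x A3 D" "\<exists>D. has_total_derivs U x A4 D"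
    unfolding A3 A4 by (rule exI, (rule has_total_derivs_intros Qd ud \<phi>d)+)+
  then obtain D3 D4 where "has_total_derivs U x A3 D3" "has_total_derivs U x A4 D4"
    by blast
  note Ad = this[THEN has_total_derivs_total_deriv]
  have id3: "\<forall>y\<in>U. \<forall>s. A3 y s = ?u y {#3,3#} * ?\<phi> y {#1#} - ?\<phi> y {#2#} - ?u y {#1,3#} * ?\<phi> y {#3#}"
    and id4: "\<forall>y\<in>U. \<forall>s. A4 y s = ?u y {#3,4#} * ?\<phi> y {#1#} - ?u y {#1,4#} * ?\<phi> y {#3#}
      - ?Q y * ?\<phi> y {#4#}"
    by (simp_all add: A3 A4)
  have idF: "\<forall>y\<in>U. \<forall>s::jet. ?u y {#2,4#} - ?u y {#1,4#} * ?u y {#3,3#} + ?u y {#1,3#} * ?u y {#3,4#}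
      - ?Q y * ?u y {#3,4#} = 0"
    using F by (simp add: eq_III_def)
  note mult = has_total_derivs_mult and diff = has_total_derivs_diff and add = has_total_derivs_add
  note [simp] = add_mset_commute
  note t3 = has_total_derivs_unique[OF U Ad(1)
      diff[OF diff[OF mult[OF ud \<phi>d] \<phi>d] mult[OF ud \<phi>d]] id3]
  note t4 = has_total_derivs_unique[OF U Ad(2)
      diff[OF diff[OF mult[OF ud \<phi>d] mult[OF ud \<phi>d]] mult[OF Qd \<phi>d]] id4]
  note tF = has_total_derivs_unique[OF U
      diff[OF add[OF diff[OF ud mult[OF ud ud]] mult[OF ud ud]] mult[OF Qd ud]]
      has_total_derivs_const idF]
  note * = has_jet_diff_eq_III[of Q x "?u x", OF Q]
  note l\<phi> = linearization_zeroD[OF lin *]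
  \<comment> \<open>The third derivatives of \<open>u\<close> cancel, and
    \<open>D\<^sub>4 A3 - D\<^sub>3 A4\<close> is exactly
    \<open>- \<ell>\<^sub>F(\<phi>)\<close>.\<close>
  have "total_deriv 4 A3 x s = total_deriv 3 A4 x s" for s
    using t3[of 4 s, simplified] t4[of 3 s, simplified] l\<phi> by algebra
  moreover have "has_jet_diff 2 (eq_III Q x) (?u x) s 0" if r: "prolongs UNIV 3 4 A3 A4 x s" for s
  proof -
    have s2: "s {#2,4#} = total_deriv 2 A4 x s" "s {#3,3#} = total_deriv 3 A3 x s"
      "s {#1,4#} = total_deriv 1 A4 x s" "s {#3,4#} = total_deriv 3 A4 x s"
      "s {#1,3#} = total_deriv 1 A3 x s" "s {#4#} = A4 x s"
      using prolongsD(1,2)[OF r] prolongsD(3,4)[OF r, of 1] prolongsD(3,4)[OF r, of 2]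
        prolongsD(3,4)[OF r, of 3] prolongsD(3,4)[OF r, of 4] by simp_all
    \<comment> \<open>Substituting the prolonged relations gives \<open>\<ell>\<^sub>F(\<psi>) = - Q
      \<ell>\<^sub>F(\<phi>) + \<phi>\<^sub>1 D\<^sub>3 F - \<phi>\<^sub>3 D\<^sub>1 F - Q'
      \<phi>\<^sub>4 F\<close>, where \<open>F\<close> is the left-hand side of the equation and
      \<open>Q'\<close> the derivative of \<open>Q\<close> in its second argument. Every term on the
      right vanishes.\<close>
    show ?thesis
      by (rule has_jet_diff_zeroI[OF *])
        (use t4[of 2 s, simplified] t3[of 3 s, simplified] t4[of 1 s, simplified]
          t4[of 3 s, simplified] t3[of 1 s, simplified] s2 tF[of 1, simplified] tF[of 3, simplified]
          l\<phi> idF[rule_format, OF U(2)] id4[rule_format, OF U(2), of s] in algebra)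
  qed
  ultimately show "(\<exists>D. has_total_derivs U x A3 D) \<and> (\<exists>D. has_total_derivs U x A4 D) \<and>
      (\<forall>s. prolongs (- {3, 4}) 3 4 A3 A4 x s \<longrightarrow> total_deriv 4 A3 x s = total_deriv 3 A4 x s) \<and>
      (\<forall>s. prolongs UNIV 3 4 A3 A4 x s \<longrightarrow> has_jet_diff 2 (eq_III Q x) (?u x) s 0)"
    using Ad by blast
qed

text \<open>Again Cramer's rule: \<open>id4\<close> and \<open>id1\<close> are linear in
  \<open>\<psi>\<^sub>2\<close>, \<open>\<psi>\<^sub>3\<close> with determinant
  \<open>- Q u\<^sub>1\<^sub>4\<close> by the equation for \<open>u\<close>. Both express
  derivatives of \<open>\<phi>\<close>, so cross-differentiating them eliminates
  \<open>\<phi>\<close>.\<close>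

lemma recursion_operator_II:
  assumes "smooth_on W Q"
  shows "recursion_operator (dom_II W Q) (eq_II Q) (rel_II Q)"
  unfolding rel_II_def
proof (rule recursion_operator_pairI)
  show "(2::4) \<noteq> 3" by simp
next
  fix U u \<phi> x and A2 A3 :: "real^4 \<Rightarrow> jet \<Rightarrow> real"
  let ?u = "jet_of u" and ?\<phi> = "jet_of \<phi>" and ?Q = "\<lambda>y. Q (y$4, jet_of u y {#4#})"
  assume U: "open U" "x \<in> U" and sm: "smooth_on U u" "smooth_on U \<phi>"
    and F: "\<And>y. y \<in> U \<Longrightarrow> eq_II Q y (?u y) = 0"
    and dom: "\<And>y. y \<in> U \<Longrightarrow> (y, ?u y) \<in> dom_II W Q"
    and lin: "linearization (eq_II Q) u \<phi> x = 0"
    and A2: "A2 = (\<lambda>y s. 1 / (?Q y * ?u y {#1,4#}) *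
      (?Q y * ?u y {#1,2#} * s {#4#} + ?u y {#2,4#} * ?\<phi> y {#1#} - ?u y {#1,2#} * ?\<phi> y {#4#}))"
    and A3: "A3 = (\<lambda>y s. 1 / (?Q y * ?u y {#1,4#}) *
      (?Q y * ?u y {#1,3#} * s {#4#} + ?u y {#3,4#} * ?\<phi> y {#1#} - ?u y {#1,3#} * ?\<phi> y {#4#}))"
  have Q: "Q differentiable (at (x$4, ?u x {#4#}))"
    using smooth_on_differentiable[OF assms] dom[OF U(2)] by (simp add: dom_II_def)
  have w: "?Q y * ?u y {#1,4#} \<noteq> 0" if "y \<in> U" for y
    using dom[OF that] by (simp add: dom_II_def)
  note Qd = has_total_derivs_fun_t_jet[OF U sm(1) Q]
  note ud = has_total_derivs_jet_of[OF U(1) sm(1) U(2)]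
  note \<phi>d = has_total_derivs_jet_of[OF U(1) sm(2) U(2)]
  note sd = has_total_derivs_coord[OF U]
  have "\<exists>D. has_total_derivs U x A2 D" "\<exists>D. has_total_derivs U x A3 D"
    unfolding A2 A3 by (rule exI, (rule has_total_derivs_intros Qd ud \<phi>d sd w[OF U(2)])+)+
  then obtain D2 D3 where "has_total_derivs U x A2 D2" "has_total_derivs U x A3 D3"
    by blast
  note Ad = this[THEN has_total_derivs_total_deriv]
  have F': "?u y {#1,2#} * ?u y {#3,4#} - ?u y {#1,3#} * ?u y {#2,4#} = ?Q y * ?u y {#1,4#}"
    if "y \<in> U" for y
    using F[OF that] by (simp add: eq_II_def)
  have id4: "\<forall>y\<in>U. \<forall>s. ?\<phi> y {#4#} = ?Q y * s {#4#} - ?u y {#3,4#} * A2 y s + ?u y {#2,4#} * A3 y s"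
    and id1: "\<forall>y\<in>U. \<forall>s. ?\<phi> y {#1#} = ?u y {#1,2#} * A3 y s - ?u y {#1,3#} * A2 y s"
  proof (safe)
    fix y s assume y: "y \<in> U"
    \<comment> \<open>Naming the reciprocal leaves polynomial goals with the single side relation
      that \<open>c\<close> times the determinant is 1.\<close>
    define c where "c = 1 / (?Q y * ?u y {#1,4#})"
    have A2': "A2 y s
        = c * (?Q y * ?u y {#1,2#} * s {#4#} + ?u y {#2,4#} * ?\<phi> y {#1#} - ?u y {#1,2#} * ?\<phi> y {#4#})"
      and A3': "A3 y s
        = c * (?Q y * ?u y {#1,3#} * s {#4#} + ?u y {#3,4#} * ?\<phi> y {#1#} - ?u y {#1,3#} * ?\<phi> y {#4#})"
      by (simp_all add: A2 A3 c_def)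
    have c: "c * (?u y {#1,2#} * ?u y {#3,4#} - ?u y {#1,3#} * ?u y {#2,4#}) = 1"
      using w[OF y] unfolding F'[OF y] c_def by simp
    show "?\<phi> y {#4#} = ?Q y * s {#4#} - ?u y {#3,4#} * A2 y s + ?u y {#2,4#} * A3 y s"
      using c unfolding A2' A3' by algebra
    show "?\<phi> y {#1#} = ?u y {#1,2#} * A3 y s - ?u y {#1,3#} * A2 y s"
      using c unfolding A2' A3' by algebra
  qed
  have idF: "\<forall>y\<in>U. \<forall>s::jet. ?u y {#1,2#} * ?u y {#3,4#} - ?u y {#1,3#} * ?u y {#2,4#}
      = ?Q y * ?u y {#1,4#}"
    using F' by simp
  note mult = has_total_derivs_mult and diff = has_total_derivs_diff and add = has_total_derivs_add
  note [simp] = add_mset_commute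
  note t4 = has_total_derivs_unique[OF U \<phi>d
      add[OF diff[OF mult[OF Qd sd] mult[OF ud Ad(1)]] mult[OF ud Ad(2)]] id4]
  note t1 = has_total_derivs_unique[OF U \<phi>d diff[OF mult[OF ud Ad(2)] mult[OF ud Ad(1)]] id1]
  note tF = has_total_derivs_unique[OF U diff[OF mult[OF ud ud] mult[OF ud ud]] mult[OF Qd ud] idF]
  note * = has_jet_diff_eq_II[of Q x "?u x", OF Q]
  note l\<phi> = linearization_zeroD[OF lin *]
  have "total_deriv 3 A2 x s = total_deriv 2 A3 x s" if r: "prolongs (- {2, 3}) 2 3 A2 A3 x s" for s
  proof -
    have s2: "s {#2,4#} = total_deriv 4 A2 x s" "s {#3,4#} = total_deriv 4 A3 x s"
      using prolongsD(3,4)[OF r, of 4] by simp_all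
    note e = t4[of 1 s, simplified] t4[of 2 s, simplified] t4[of 3 s, simplified]
      t1[of 4 s, simplified] t1[of 2 s, simplified] t1[of 3 s, simplified]
      tF[of 2, simplified] tF[of 3, simplified] id4[rule_format, OF U(2), of s]
    \<comment> \<open>substituting \<open>id4\<close> and \<open>id1\<close> into \<open>\<ell>\<^sub>F(\<phi>)\<close>\<close>
    have "(?Q x * ?u x {#1,4#}) * (total_deriv 3 A2 x s - total_deriv 2 A3 x s) = 0"
      using e[unfolded s2] l\<phi> F'[OF U(2)] by algebra
    then show ?thesis using w[OF U(2)] by simp
  qed
  moreover have "has_jet_diff 2 (eq_II Q x) (?u x) s 0" if r: "prolongs UNIV 2 3 A2 A3 x s" for s
  proof -
    have s2: "s {#1,2#} = total_deriv 1 A2 x s" "s {#1,3#} = total_deriv 1 A3 x s"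
      "s {#2,4#} = total_deriv 4 A2 x s" "s {#3,4#} = total_deriv 4 A3 x s"
      using prolongsD(3,4)[OF r, of 1] prolongsD(3,4)[OF r, of 4] by simp_all
    \<comment> \<open>\<open>D\<^sub>1\<close> of \<open>id4\<close> minus \<open>D\<^sub>4\<close> of \<open>id1\<close>\<close>
    show ?thesis
      by (rule has_jet_diff_zeroI[OF *])
        (use t4[of 1 s, simplified] t1[of 4 s, simplified] s2 in algebra)
  qed
  ultimately show "(\<exists>D. has_total_derivs U x A2 D) \<and> (\<exists>D. has_total_derivs U x A3 D) \<and>
      (\<forall>s. prolongs (- {2, 3}) 2 3 A2 A3 x s \<longrightarrow> total_deriv 3 A2 x s = total_deriv 2 A3 x s) \<and>
      (\<forall>s. prolongs UNIV 2 3 A2 A3 x s \<longrightarrow> has_jet_diff 2 (eq_II Q x) (?u x) s 0)"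
    using Ad by blast
qed

lemma recursion_operator_I:
  assumes "smooth_on W Q"
  shows "recursion_operator (dom_I W) (eq_I Q) (rel_I Q)"
  unfolding rel_I_def
proof (rule recursion_operator_pairI)
  show "(1::4) \<noteq> 3" by simp
next
  fix U u \<phi> x and A1 A3 :: "real^4 \<Rightarrow> jet \<Rightarrow> real"
  let ?u = "jet_of u" and ?\<phi> = "jet_of \<phi>" and ?Q = "\<lambda>y. Q (y$4, jet_of u y {#4#})"
  assume U: "open U" "x \<in> U" and sm: "smooth_on U u" "smooth_on U \<phi>"
    and F: "\<And>y. y \<in> U \<Longrightarrow> eq_I Q y (?u y) = 0"
    and dom: "\<And>y. y \<in> U \<Longrightarrow> (y, ?u y) \<in> dom_I W"
    and lin: "linearization (eq_I Q) u \<phi> x = 0"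
    and A1: "A1 = (\<lambda>y s. ?Q y * (?u y {#1,4#} / ?u y {#2,4#}) * ?\<phi> y {#2#} - ?\<phi> y {#1#}
      - (?Q y - 1) * (?u y {#1,2#} / ?u y {#2,4#}) * ?\<phi> y {#4#} + ?u y {#1,2#} / ?u y {#2,4#} * s {#4#})"
    and A3: "A3 = (\<lambda>y s. (?Q y - 1) * (?u y {#3,4#} / ?u y {#2,4#}) * ?\<phi> y {#2#}
      - (?Q y - 1) * (?u y {#2,3#} / ?u y {#2,4#}) * ?\<phi> y {#4#} + ?u y {#2,3#} / ?u y {#2,4#} * s {#4#})"
  have Q: "Q differentiable (at (x$4, ?u x {#4#}))"
    using smooth_on_differentiable[OF assms] dom[OF U(2)] by (simp add: dom_I_def)
  have w: "?u y {#2,4#} \<noteq> 0" if "y \<in> U" for y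
    using dom[OF that] by (simp add: dom_I_def)
  note Qd = has_total_derivs_fun_t_jet[OF U sm(1) Q]
  note ud = has_total_derivs_jet_of[OF U(1) sm(1) U(2)]
  note \<phi>d = has_total_derivs_jet_of[OF U(1) sm(2) U(2)]
  note sd = has_total_derivs_coord[OF U]
  have "\<exists>D. has_total_derivs U x A1 D" "\<exists>D. has_total_derivs U x A3 D"
    unfolding A1 A3 by (rule exI, (rule has_total_derivs_intros Qd ud \<phi>d sd w[OF U(2)])+)+
  then obtain D1 D3 where "has_total_derivs U x A1 D1" "has_total_derivs U x A3 D3"
    by blast
  note Ad = this[THEN has_total_derivs_total_deriv]
  have F': "?u y {#1,2#} * ?u y {#3,4#} - ?u y {#1,3#} * ?u y {#2,4#}
      = ?Q y * (?u y {#1,2#} * ?u y {#3,4#} - ?u y {#1,4#} * ?u y {#2,3#})" if "y \<in> U" for y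
    using F[OF that] by (simp add: eq_I_def)
  have id14: "\<forall>y\<in>U. \<forall>s. ?u y {#2,4#} * (A1 y s + ?\<phi> y {#1#})
      = ?Q y * (?u y {#1,4#} * ?\<phi> y {#2#}) + ?u y {#1,2#} * (s {#4#} - (?Q y - 1) * ?\<phi> y {#4#})"
    and id34: "\<forall>y\<in>U. \<forall>s. ?u y {#2,4#} * A3 y s
      = (?Q y - 1) * (?u y {#3,4#} * ?\<phi> y {#2#}) + ?u y {#2,3#} * (s {#4#} - (?Q y - 1) * ?\<phi> y {#4#})"
    using w by (auto simp: A1 A3 field_simps)
  \<comment> \<open>\<open>id13\<close> eliminates
    \<open>\<psi>\<^sub>4 - (Q - 1) \<phi>\<^sub>4\<close> from \<open>id14\<close> and
    \<open>id34\<close>, and \<open>id134\<close> eliminates \<open>\<phi>\<^sub>2\<close>. In both,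
    the coefficient \<open>Q u\<^sub>1\<^sub>4 u\<^sub>2\<^sub>3 - (Q - 1) u\<^sub>1\<^sub>2
    u\<^sub>3\<^sub>4\<close> equals \<open>u\<^sub>1\<^sub>3 u\<^sub>2\<^sub>4\<close> by the
    equation, so a common factor \<open>u\<^sub>2\<^sub>4\<close> can be cancelled.\<close>
  have id13: "\<forall>y\<in>U. \<forall>s. ?u y {#2,3#} * (A1 y s + ?\<phi> y {#1#}) - ?u y {#1,2#} * A3 y s
      = ?u y {#1,3#} * ?\<phi> y {#2#}"
    and id134: "\<forall>y\<in>U. \<forall>s. ?Q y * (?u y {#1,4#} * A3 y s) - ?u y {#1,3#} * s {#4#}
        - (?Q y - 1) * (?u y {#3,4#} * A1 y s)
      = (?Q y - 1) * (?u y {#3,4#} * ?\<phi> y {#1#} - ?u y {#1,3#} * ?\<phi> y {#4#})"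
  proof (safe)
    fix y s assume y: "y \<in> U"
    note e = id14[rule_format, OF y, of s] id34[rule_format, OF y, of s] F'[OF y]
    have "?u y {#2,4#} * (?u y {#2,3#} * (A1 y s + ?\<phi> y {#1#}) - ?u y {#1,2#} * A3 y s)
        = ?u y {#2,4#} * (?u y {#1,3#} * ?\<phi> y {#2#})"
      using e by algebra
    then show "?u y {#2,3#} * (A1 y s + ?\<phi> y {#1#}) - ?u y {#1,2#} * A3 y s = ?u y {#1,3#} * ?\<phi> y {#2#}"
      using w[OF y] by simp
    have "?u y {#2,4#} * (?Q y * (?u y {#1,4#} * A3 y s) - ?u y {#1,3#} * s {#4#}
        - (?Q y - 1) * (?u y {#3,4#} * A1 y s))
      = ?u y {#2,4#} * ((?Q y - 1) * (?u y {#3,4#} * ?\<phi> y {#1#} - ?u y {#1,3#} * ?\<phi> y {#4#}))"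
      using e by algebra
    then show "?Q y * (?u y {#1,4#} * A3 y s) - ?u y {#1,3#} * s {#4#}
        - (?Q y - 1) * (?u y {#3,4#} * A1 y s)
      = (?Q y - 1) * (?u y {#3,4#} * ?\<phi> y {#1#} - ?u y {#1,3#} * ?\<phi> y {#4#})"
      using w[OF y] by simp
  qed
  note mult = has_total_derivs_mult and diff = has_total_derivs_diff and add = has_total_derivs_add
  note [simp] = add_mset_commute
  note Q1d = diff[OF Qd has_total_derivs_const[of _ _ 1]]
  note sQ = diff[OF sd mult[OF Q1d \<phi>d]]
  note t14 = has_total_derivs_unique[OF U mult[OF ud add[OF Ad(1) \<phi>d]]
      add[OF mult[OF Qd mult[OF ud \<phi>d]] mult[OF ud sQ]] id14]
  note t34 = has_total_derivs_unique[OF U mult[OF ud Ad(2)]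
      add[OF mult[OF Q1d mult[OF ud \<phi>d]] mult[OF ud sQ]] id34]
  note t13 = has_total_derivs_unique[OF U diff[OF mult[OF ud add[OF Ad(1) \<phi>d]] mult[OF ud Ad(2)]]
      mult[OF ud \<phi>d] id13]
  note t134 = has_total_derivs_unique[OF U
      diff[OF diff[OF mult[OF Qd mult[OF ud Ad(2)]] mult[OF ud sd]] mult[OF Q1d mult[OF ud Ad(1)]]]
      mult[OF Q1d diff[OF mult[OF ud \<phi>d] mult[OF ud \<phi>d]]] id134]
  note * = has_jet_diff_eq_I[of Q x "?u x", OF Q]
  note l\<phi> = linearization_zeroD[OF lin *]
  have "total_deriv 3 A1 x s = total_deriv 1 A3 x s" if r: "prolongs (- {1, 3}) 1 3 A1 A3 x s" for s
  proof -
    have s2: "s {#1,4#} = total_deriv 4 A1 x s" "s {#3,4#} = total_deriv 4 A3 x s"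
      using prolongsD(3,4)[OF r, of 4] by simp_all
    \<comment> \<open>\<open>D\<^sub>4\<close> of \<open>id13\<close> minus \<open>D\<^sub>3\<close> of \<open>id14\<close> plus \<open>D\<^sub>1\<close> of \<open>id34\<close>; the left-hand sides of these relations
      are, for \<open>\<phi> = 0\<close>, components of \<open>d\<psi> \<and> du\<^sub>2\<close>, a closed form.\<close>
    have "?u x {#2,4#} * (total_deriv 3 A1 x s - total_deriv 1 A3 x s) = 0"
      using t13[of 4 s, simplified] t34[of 1 s, simplified, unfolded s2]
        t14[of 3 s, simplified, unfolded s2] l\<phi> by algebra
    then show ?thesis using w[OF U(2)] by simp
  qed
  moreover have "has_jet_diff 2 (eq_I Q x) (?u x) s 0" if r: "prolongs UNIV 1 3 A1 A3 x s" for s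
  proof -
    have s2: "s {#1,2#} = total_deriv 2 A1 x s" "s {#2,3#} = total_deriv 2 A3 x s"
      "s {#1,4#} = total_deriv 4 A1 x s" "s {#3,4#} = total_deriv 4 A3 x s"
      "s {#1,3#} = total_deriv 3 A1 x s"
      using prolongsD(3,4)[OF r, of 2] prolongsD(3,4)[OF r, of 3]
        prolongsD(3,4)[OF r, of 4] by simp_all
    \<comment> \<open>\<open>D\<^sub>2\<close> of \<open>id134\<close> plus \<open>Q\<close> times \<open>D\<^sub>4\<close> of \<open>id13\<close> minus \<open>D\<^sub>3\<close> of \<open>id14\<close>\<close>
    show ?thesis
      by (rule has_jet_diff_zeroI[OF *])
        (use t134[of 2 s, simplified] t13[of 4 s, simplified] t14[of 3 s, simplified] s2 l\<phi>
        id14[rule_format, OF U(2), of s] id34[rule_format, OF U(2), of s] F'[OF U(2)] in algebra)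
  qed
  ultimately show "(\<exists>D. has_total_derivs U x A1 D) \<and> (\<exists>D. has_total_derivs U x A3 D) \<and>
      (\<forall>s. prolongs (- {1, 3}) 1 3 A1 A3 x s \<longrightarrow> total_deriv 3 A1 x s = total_deriv 1 A3 x s) \<and>
      (\<forall>s. prolongs UNIV 1 3 A1 A3 x s \<longrightarrow> has_jet_diff 2 (eq_I Q x) (?u x) s 0)"
    using Ad by blast
qed

theorem mainTheorem5:
  fixes q b Q :: "real \<times> real \<Rightarrow> real"
    and V W :: "(real \<times> real) set"
  assumes "open V" and "smooth_on V q" and "smooth_on V b"
    and "open W" and "smooth_on W Q"
  shows "recursion_operator (dom_D V q b) (eq_D q b) (rel_D q b)
    \<and> recursion_operator (dom_III W) (eq_III Q) (rel_III Q)
    \<and> recursion_operator (dom_II W Q) (eq_II Q) (rel_II Q)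
    \<and> recursion_operator (dom_I W) (eq_I Q) (rel_I Q)"
  using recursion_operator_D[OF assms(2,3)] recursion_operator_III[OF assms(5)]
    recursion_operator_II[OF assms(5)] recursion_operator_I[OF assms(5)]
  by blast

end
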